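(* Let $k$ be a field, $S=k[x_1,\dots,x_n]$, $\mathfrak m=(x_1,\dots,x_n)$, and $I=(f_1,\dots,f_r)$ a linearly presented $\mathfrak m$-primary ideal of $S$. Let $\Phi:\mathbb P^{n-1}\to\mathbb P^{r-1}$ be the map defined by $f_1,\dots,f_r$, $W$ its image, $B=k[T_1,\dots,T_r]$, and $I(W)\subseteq B$ the homogeneous ideal of $W$. Let $\Theta$ be the Jacobian dual matrix of a presentation matrix of $I$ and $I_n(\Theta)$ its ideal of $n\times n$ minors. Then $$I_n(\Theta)^{\mathrm{sat}}=I(W),$$ i.e. $W$ is scheme-theoretically defined by the maximal minors of $\Theta$.
   Context: "Linearly presented" means $I$ is generated by forms of a common degree and its syzygy module is generated by linear syzygies $\sum_i a_i(\mathbf x)f_i=0$. The defining ideal $J$ of $\mathrm{Sym}(I)$ in $k[\mathbf x,\mathbf T]$ is generated by the bilinear forms $\sum_i a_i(\mathbf x)T_i$; with $L_1,\dots,L_N$ minimal generators of $J$, the Jacobian dual $\Theta$ is the $N\times n$ matrix of linear forms in the $T_i$ with $\Theta(x_1,\dots,x_n)^T=(L_1,\dots,L_N)^T$. $I(W)$ is the kernel of $B\to S$, $T_i\mapsto f_i$. Saturation is with respect to $(T_1,\dots,T_r)$. *)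

theory Defs
  imports "HOL-Library.Poly_Mapping" "HOL-Combinatorics.Permutations"
begin

text \<open>Multivariate polynomials over a field: finitely supported maps from monomials
  (finitely supported exponent vectors nat =>0 nat) to coefficients.
  The variables x_1..x_n are Var 0..Var (n-1); the variables T_1..T_r are
  Var n..Var (n+r-1).  Thus S = poly_ring {..<n}, B = poly_ring {n..<n+r},
  k[x,T] = poly_ring {..<n+r}.\<close>

type_synonym 'k mpoly = "(nat \<Rightarrow>\<^sub>0 nat) \<Rightarrow>\<^sub>0 'k"

definition Var :: "nat \<Rightarrow> 'k::comm_ring_1 mpoly" where
  "Var v = Poly_Mapping.single (Poly_Mapping.single v 1) 1"

definition poly_ring :: "nat set \<Rightarrow> 'k::comm_ring_1 mpoly set" where
  "poly_ring V = {p :: 'k mpoly. \<forall>m\<in>Poly_Mapping.keys p. Poly_Mapping.keys m \<subseteq> V}"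

definition mdeg :: "nat set \<Rightarrow> (nat \<Rightarrow>\<^sub>0 nat) \<Rightarrow> nat" where
  "mdeg V m = (\<Sum>v\<in>Poly_Mapping.keys m \<inter> V. Poly_Mapping.lookup m v)"

definition homogeneous :: "nat \<Rightarrow> 'k::comm_ring_1 mpoly \<Rightarrow> bool" where
  "homogeneous d p \<longleftrightarrow> (\<forall>m\<in>Poly_Mapping.keys p. mdeg UNIV m = d)"

definition gen_ideal :: "nat set \<Rightarrow> 'k::comm_ring_1 mpoly set \<Rightarrow> 'k mpoly set" where
  "gen_ideal V G = {\<Sum>g\<in>F. c g * g | F c. finite F \<and> F \<subseteq> G \<and> (\<forall>g\<in>F. c g \<in> poly_ring V)}"

definition radical :: "nat set \<Rightarrow> 'k::comm_ring_1 mpoly set \<Rightarrow> 'k mpoly set" where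
  "radical V I = {p \<in> poly_ring V. \<exists>k. p ^ k \<in> I}"

text \<open>An ideal I of S = k[x_1..x_n] is m-primary: primary with radical m.
  Since m is maximal, this is the same as having radical m.\<close>
definition m_primary :: "nat \<Rightarrow> 'k::comm_ring_1 mpoly set \<Rightarrow> bool" where
  "m_primary n I \<longleftrightarrow>
     radical {..<n} I = gen_ideal {..<n} (Var ` {..<n}) \<and>
     (\<forall>a\<in>poly_ring {..<n}. \<forall>b\<in>poly_ring {..<n}.
        a * b \<in> I \<longrightarrow> a \<in> I \<or> b \<in> radical {..<n} I)"

definition syzygies :: "nat \<Rightarrow> nat \<Rightarrow> (nat \<Rightarrow> 'k::comm_ring_1 mpoly) \<Rightarrow> (nat \<Rightarrow> 'k mpoly) set" where
  "syzygies n r f = {a. (\<forall>i<r. a i \<in> poly_ring {..<n}) \<and> (\<forall>i\<ge>r. a i = 0)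
                       \<and> (\<Sum>i<r. a i * f i) = 0}"

definition linear_form :: "nat set \<Rightarrow> 'k::comm_ring_1 mpoly \<Rightarrow> bool" where
  "linear_form V p \<longleftrightarrow> p \<in> poly_ring V \<and> homogeneous 1 p"

definition linear_syzygies :: "nat \<Rightarrow> nat \<Rightarrow> (nat \<Rightarrow> 'k::comm_ring_1 mpoly) \<Rightarrow> (nat \<Rightarrow> 'k mpoly) set" where
  "linear_syzygies n r f = {a \<in> syzygies n r f. \<forall>i<r. linear_form {..<n} (a i)}"

definition gen_submodule :: "nat \<Rightarrow> (nat \<Rightarrow> 'k::comm_ring_1 mpoly) set \<Rightarrow> (nat \<Rightarrow> 'k mpoly) set" where
  "gen_submodule n M = {(\<lambda>i. \<Sum>v\<in>F. c v * v i) | F c. finite F \<and> F \<subseteq> M \<and>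
                           (\<forall>v\<in>F. c v \<in> poly_ring {..<n})}"

definition linearly_presented :: "nat \<Rightarrow> nat \<Rightarrow> (nat \<Rightarrow> 'k::comm_ring_1 mpoly) \<Rightarrow> bool" where
  "linearly_presented n r f \<longleftrightarrow>
     (\<exists>d. \<forall>i<r. homogeneous d (f i)) \<and>
     syzygies n r f = gen_submodule n (linear_syzygies n r f)"

text \<open>Defining ideal J of Sym(I) in k[x,T], with T_i = Var (n+i).\<close>
definition sym_ideal :: "nat \<Rightarrow> nat \<Rightarrow> (nat \<Rightarrow> 'k::comm_ring_1 mpoly) \<Rightarrow> 'k mpoly set" where
  "sym_ideal n r f = gen_ideal {..<n+r}
     {(\<Sum>i<r. a i * Var (n + i)) | a. a \<in> linear_syzygies n r f}"

definition bilinear :: "nat \<Rightarrow> nat \<Rightarrow> 'k::comm_ring_1 mpoly \<Rightarrow> bool" where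
  "bilinear n r p \<longleftrightarrow> p \<in> poly_ring {..<n+r} \<and>
     (\<forall>m\<in>Poly_Mapping.keys p. mdeg {..<n} m = 1 \<and> mdeg {n..<n+r} m = 1)"

definition det_fun :: "nat \<Rightarrow> (nat \<Rightarrow> nat \<Rightarrow> 'a::comm_ring_1) \<Rightarrow> 'a" where
  "det_fun n M = (\<Sum>p | p permutes {..<n}. of_int (sign p) * (\<Prod>i<n. M i (p i)))"

definition maximal_minors :: "nat \<Rightarrow> nat \<Rightarrow> (nat \<Rightarrow> nat \<Rightarrow> 'a::comm_ring_1) \<Rightarrow> 'a set" where
  "maximal_minors N n M = {det_fun n (\<lambda>i l. M (\<rho> i) l) | \<rho>.
      strict_mono_on {..<n} \<rho> \<and> \<rho> ` {..<n} \<subseteq> {..<N}}"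

primrec ideal_pow :: "nat set \<Rightarrow> 'k::comm_ring_1 mpoly set \<Rightarrow> nat \<Rightarrow> 'k mpoly set" where
  "ideal_pow V J 0 = poly_ring V"
| "ideal_pow V J (Suc k) = gen_ideal V {a * b | a b. a \<in> J \<and> b \<in> ideal_pow V J k}"

definition saturation :: "nat set \<Rightarrow> 'k::comm_ring_1 mpoly set \<Rightarrow> 'k mpoly set \<Rightarrow> 'k mpoly set" where
  "saturation V I Q = {p \<in> poly_ring V. \<exists>k. \<forall>q\<in>ideal_pow V Q k. q * p \<in> I}"

definition subst :: "(nat \<Rightarrow> 'k::comm_ring_1 mpoly) \<Rightarrow> 'k mpoly \<Rightarrow> 'k mpoly" where
  "subst \<sigma> p = (\<Sum>m\<in>Poly_Mapping.keys p. Poly_Mapping.single 0 (Poly_Mapping.lookup p m) *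
                    (\<Prod>v\<in>Poly_Mapping.keys m. \<sigma> v ^ Poly_Mapping.lookup m v))"

definition image_ideal :: "nat \<Rightarrow> nat \<Rightarrow> (nat \<Rightarrow> 'k::comm_ring_1 mpoly) \<Rightarrow> 'k mpoly set" where
  "image_ideal n r f = {p \<in> poly_ring {n..<n+r}. subst (\<lambda>v. f (v - n)) p = 0}"

end

theory Submission
  imports Defs "Jordan_Normal_Form.Determinant"
begin

text \<open>
  Write \<open>x\<close> for the variables of \<open>S\<close> and \<open>T\<close> for those of \<open>B\<close>, and let \<open>J\<close> be generated by the entries of
  \<open>\<Theta> x\<close>. At \<open>T = f\<close> the vector \<open>x\<close> is a nonzero kernel vector of \<open>\<Theta>\<close>, so the maximal minors vanish on
  \<open>W\<close>; since \<open>S\<close> is a domain, so does the saturation.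

  Conversely, write \<open>x_l ^ k = (\<Sum>j. c_j f_j)\<close> and \<open>u = (\<Sum>j. c_j T_j)\<close>. The Koszul syzygies give
  \<open>x_l ^ k T_i \<equiv> f_i u\<close> modulo \<open>J\<close>, so a form \<open>p\<close> of degree \<open>s\<close> in \<open>I(W)\<close> satisfies
  \<open>x_l ^ (k s) p \<equiv> u ^ s p(f) = 0\<close>. Substituting for \<open>x\<close> the cofactors of \<open>n - 1\<close> rows of \<open>\<Theta>\<close> turns \<open>J\<close> into
  maximal minors and some \<open>x_l\<close> into a given minor \<open>\<delta>\<close> of size \<open>n - 1\<close>, hence some \<open>\<delta> ^ K p\<close> lies in
  \<open>I_n(\<Theta>)\<close>. It remains to see that each \<open>T_i\<close> lies in the radical of \<open>I_(n-1)(\<Theta>)\<close>. Geometrically, the fibres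
  of the map are linear because the equations are bilinear, and finite because the ideal is primary to
  the maximal ideal, so they are reduced points; algebraically, one climbs from minors of size \<open>e\<close> to
  minors of size \<open>e + 1\<close> by restricting the same congruence to a line in the kernel of \<open>\<Theta>\<close>.

  All ideals are taken in the ring of all polynomials and retracted to \<open>B\<close> at the end.
\<close>

subsection \<open>Ideals and radicals\<close>

text \<open>A commutative ring is a module over itself whose submodules are its ideals, so the
  library facts on \<open>span\<close> and \<open>subspace\<close> become facts on generated
  ideals.\<close>

lemma module_times: "Modules.module ((*) :: 'a::comm_ring_1 \<Rightarrow> 'a \<Rightarrow> 'a)"
  by unfold_locales (simp_all add: algebra_simps)

abbreviation ideal_span :: "'a::comm_ring_1 set \<Rightarrow> 'a set" where
  "ideal_span \<equiv> Modules.module.span (*)"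

abbreviation is_ideal :: "'a::comm_ring_1 set \<Rightarrow> bool" where
  "is_ideal \<equiv> Modules.module.subspace (*)"

lemmas is_idealI = Modules.module.subspaceI[OF module_times]
lemmas ideal_0 = Modules.module.subspace_0[OF module_times]
lemmas ideal_add = Modules.module.subspace_add[OF module_times]
lemmas ideal_mult_left = Modules.module.subspace_scale[OF module_times]
lemmas ideal_diff = Modules.module.subspace_diff[OF module_times]
lemmas ideal_sum = Modules.module.subspace_sum[OF module_times]
lemmas is_ideal_span = Modules.module.subspace_span[OF module_times]
lemmas ideal_span_base = Modules.module.span_base[OF module_times]
lemmas ideal_span_minimal = Modules.module.span_minimal[OF module_times]
lemmas ideal_span_explicit = Modules.module.span_explicit[OF module_times]

lemma ideal_mult_right: "is_ideal I \<Longrightarrow> x \<in> I \<Longrightarrow> x * c \<in> I"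
  using ideal_mult_left[of I x c] by (simp add: mult.commute)

lemma ideal_power_mono:
  assumes "is_ideal I" "x ^ a \<in> I" "a \<le> b"
  shows "x ^ b \<in> I"
  using ideal_mult_left[OF assms(1,2), of "x ^ (b - a)"] assms(3)
  by (simp add: power_add[symmetric])

lemma ideal_congruence_mult:
  assumes "is_ideal I" "a - b \<in> I" "c - d \<in> I"
  shows "a * c - b * d \<in> I"
proof -
  have "a * c - b * d = c * (a - b) + b * (c - d)"
    by (simp add: algebra_simps)
  then show ?thesis
    using assms by (metis ideal_add ideal_mult_left)
qed

lemma ideal_mult_cong:
  assumes "is_ideal I" "a - b \<in> I" "b * c \<in> I"
  shows "a * c \<in> I"
  using ideal_add[OF assms(1) ideal_mult_right[OF assms(1,2), of c] assms(3)] by (simp add: left_diff_distrib)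

lemma ideal_congruence_power:
  assumes "is_ideal I" "a - b \<in> I"
  shows "a ^ k - b ^ k \<in> I"
  by (induction k) (use assms in \<open>auto intro: ideal_congruence_mult simp: ideal_0\<close>)

lemma ideal_congruence_prod:
  assumes "is_ideal I" "\<And>i. i \<in> A \<Longrightarrow> a i - b i \<in> I"
  shows "prod a A - prod b A \<in> I"
  using assms(2)
  by (induction A rule: infinite_finite_induct)
     (use assms(1) in \<open>auto intro: ideal_congruence_mult simp: ideal_0\<close>)

text \<open>The preimage of an ideal under a ring homomorphism is an ideal, so only generators have
  to be checked.\<close>

lemma ideal_span_hom_image:
  assumes "comm_ring_hom h" "is_ideal I" "\<And>g. g \<in> G \<Longrightarrow> h g \<in> I" "x \<in> ideal_span G"
  shows "h x \<in> I"
proof -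
  interpret comm_ring_hom h by fact
  have "is_ideal {x. h x \<in> I}"
    using assms(2) by (intro is_idealI) (auto simp: hom_distribs ideal_0 ideal_add ideal_mult_left)
  then have "ideal_span G \<subseteq> {x. h x \<in> I}"
    using assms(3) by (intro ideal_span_minimal) auto
  then show ?thesis
    using assms(4) by auto
qed

text \<open>The exponent 0 is harmless: for an ideal \<open>I\<close> it applies only if
  \<open>1 \<in> I\<close>, and then the radical is the whole ring anyway.\<close>

definition ideal_rad :: "'a::comm_ring_1 set \<Rightarrow> 'a set" where
  "ideal_rad I = {a. \<exists>k. a ^ k \<in> I}"

lemma is_ideal_rad:
  fixes I :: "'a::comm_ring_1 set"
  assumes "is_ideal I"
  shows "is_ideal (ideal_rad I)"
proof (intro is_idealI)
  have "0 ^ 1 \<in> I"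
    using ideal_0[OF assms] by simp
  then show "0 \<in> ideal_rad I"
    unfolding ideal_rad_def by blast
next
  fix a b :: 'a
  assume "a \<in> ideal_rad I" "b \<in> ideal_rad I"
  then obtain k l where kl: "a ^ k \<in> I" "b ^ l \<in> I"
    by (auto simp: ideal_rad_def)
  have "(a + b) ^ (k + l) = (\<Sum>i\<le>k + l. of_nat (k + l choose i) * a ^ i * b ^ (k + l - i))"
    by (rule binomial_ring)
  also have "\<dots> \<in> I"
  proof (intro ideal_sum[OF assms])
    fix i assume "i \<in> {..k + l}"
    then consider "k \<le> i" | "l \<le> k + l - i"
      by fastforce
    then show "of_nat (k + l choose i) * a ^ i * b ^ (k + l - i) \<in> I"
    proof cases
      case 1
      then show ?thesis
        using ideal_power_mono[OF assms kl(1)] assms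
        by (intro ideal_mult_right ideal_mult_left)
    next
      case 2
      then show ?thesis
        using ideal_power_mono[OF assms kl(2)] assms by (intro ideal_mult_left)
    qed
  qed
  finally show "a + b \<in> ideal_rad I"
    by (auto simp: ideal_rad_def)
next
  fix c a :: 'a
  assume "a \<in> ideal_rad I"
  then show "c * a \<in> ideal_rad I"
    using ideal_mult_left[OF assms] by (auto simp: ideal_rad_def power_mult_distrib)
qed

lemma ideal_rad_powerD: "a ^ k \<in> ideal_rad I \<Longrightarrow> a \<in> ideal_rad I"
  by (auto simp: ideal_rad_def power_mult[symmetric])

lemma is_ideal_colon:
  assumes "is_ideal I"
  shows "is_ideal {a. a * p \<in> I}"
  using assms by (intro is_idealI)
    (auto simp: ideal_0 distrib_right ideal_add mult.assoc ideal_mult_left)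

text \<open>This is the extension of \<open>Q\<close> to polynomials in one more variable; it allows
  congruences along a line to be read off coefficient by coefficient.\<close>

lemma is_ideal_coeffs:
  assumes "is_ideal Q"
  shows "is_ideal {p. \<forall>i. coeff p i \<in> Q}"
  using assms
  by (intro is_idealI) (auto simp: ideal_0 ideal_add coeff_mult intro!: ideal_sum ideal_mult_left)

text \<open>If \<open>coeff g 0\<close> were a unit modulo \<open>Q\<close>, then \<open>h\<close> would vanish modulo \<open>Q\<close> below degree \<open>k\<close>,
  hence entirely. Clearing denominators gives the statement.\<close>

lemma coeff_0_power_mult_in_ideal:
  assumes Q: "is_ideal Q" and "degree h < k"
    and low: "\<And>i. i < k \<Longrightarrow> coeff (g * h) i \<in> Q"
  shows "coeff g 0 ^ k * coeff (g * h) k \<in> Q"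
proof -
  let ?g = "coeff g 0"
  \<comment> \<open>The coefficients of \<open>h\<close> are solved for recursively, each one
    costing a further factor \<open>?g\<close>.\<close>
  have h: "?g ^ Suc a * coeff h a \<in> Q" if "a < k" for a
    using that
  proof (induction a rule: less_induct)
    case (less a)
    have "coeff (g * h) a = ?g * coeff h a + (\<Sum>i=1..a. coeff g i * coeff h (a - i))"
      by (simp add: coeff_mult atMost_atLeast0 sum.atLeast_Suc_atMost)
    then have eq: "?g ^ Suc a * coeff h a
        = ?g ^ a * coeff (g * h) a - (\<Sum>i=1..a. ?g ^ a * (coeff g i * coeff h (a - i)))"
      by (simp add: sum_distrib_left algebra_simps)
    have "?g ^ a * (coeff g i * coeff h (a - i)) \<in> Q" if "i \<in> {1..a}" for i
    proof -
      have "?g ^ Suc (a - i) * coeff h (a - i) \<in> Q"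
        using less that by auto
      then have "(?g ^ (i - 1) * coeff g i) * (?g ^ Suc (a - i) * coeff h (a - i)) \<in> Q"
        by (rule ideal_mult_left[OF Q])
      also have "(?g ^ (i - 1) * coeff g i) * (?g ^ Suc (a - i) * coeff h (a - i))
          = ?g ^ (i - 1 + Suc (a - i)) * (coeff g i * coeff h (a - i))"
        by (simp only: power_add mult_ac)
      also have "i - 1 + Suc (a - i) = a"
        using that by auto
      finally show ?thesis .
    qed
    then show ?case
      unfolding eq by (intro ideal_diff[OF Q] ideal_sum[OF Q] ideal_mult_left[OF Q low[OF less.prems]])
  qed
  \<comment> \<open>For \<open>i = 0\<close> the coefficient of \<open>h\<close> is zero by the
    degree bound; for \<open>i > 0\<close> at most \<open>k\<close> factors \<open>?g\<close> are
    required.\<close>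
  have "?g ^ k * coeff h (k - i) \<in> Q" if "i \<le> k" for i
  proof (cases "i = 0")
    case True
    then show ?thesis
      using assms(2) by (simp add: coeff_eq_0 ideal_0[OF Q])
  next
    case False
    then have "?g ^ (i - 1) * (?g ^ Suc (k - i) * coeff h (k - i)) \<in> Q"
      using that by (intro ideal_mult_left[OF Q] h) auto
    also have "?g ^ (i - 1) * (?g ^ Suc (k - i) * coeff h (k - i)) = ?g ^ (i - 1 + Suc (k - i)) * coeff h (k - i)"
      by (simp only: power_add mult_ac)
    also have "i - 1 + Suc (k - i) = k"
      using that False by auto
    finally show ?thesis .
  qed
  then have "(\<Sum>i\<le>k. coeff g i * (?g ^ k * coeff h (k - i))) \<in> Q"
    by - (rule ideal_sum[OF Q], rule ideal_mult_left[OF Q], simp)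
  then show ?thesis
    by (simp add: coeff_mult sum_distrib_left mult_ac)
qed

subsection \<open>Evaluation of polynomials\<close>

abbreviation Const :: "'k::comm_ring_1 \<Rightarrow> 'k mpoly" where
  "Const \<equiv> Poly_Mapping.single 0"

lemma comm_ring_hom_Const: "comm_ring_hom (Const :: 'k::comm_ring_1 \<Rightarrow> 'k mpoly)"
  by unfold_locales (simp_all add: single_add mult_single)

definition mon_eval :: "(nat \<Rightarrow> 'a::comm_ring_1) \<Rightarrow> (nat \<Rightarrow>\<^sub>0 nat) \<Rightarrow> 'a" where
  "mon_eval \<sigma> m = (\<Prod>v\<in>Poly_Mapping.keys m. \<sigma> v ^ Poly_Mapping.lookup m v)"

text \<open>The coefficient map \<open>\<iota>\<close> is a parameter so that values may lie in
  another ring; later this is a polynomial ring over \<open>'k mpoly\<close>.\<close>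

definition mp_eval :: "('k::comm_ring_1 \<Rightarrow> 'a::comm_ring_1) \<Rightarrow> (nat \<Rightarrow> 'a) \<Rightarrow> 'k mpoly \<Rightarrow> 'a" where
  "mp_eval \<iota> \<sigma> p = (\<Sum>m\<in>Poly_Mapping.keys p. \<iota> (Poly_Mapping.lookup p m) * mon_eval \<sigma> m)"

lemma subst_eq_mp_eval: "subst \<sigma> = mp_eval Const \<sigma>"
  by (simp add: fun_eq_iff subst_def mp_eval_def mon_eval_def)

lemma mon_eval_superset:
  assumes "finite A" "Poly_Mapping.keys m \<subseteq> A"
  shows "mon_eval \<sigma> m = (\<Prod>v\<in>A. \<sigma> v ^ Poly_Mapping.lookup m v)"
  unfolding mon_eval_def using assms by (intro prod.mono_neutral_left) (auto simp: in_keys_iff)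

lemma mon_eval_add: "mon_eval \<sigma> (m + m') = mon_eval \<sigma> m * mon_eval \<sigma> m'"
proof -
  let ?A = "Poly_Mapping.keys m \<union> Poly_Mapping.keys m'"
  have "mon_eval \<sigma> (m + m') = (\<Prod>v\<in>?A. \<sigma> v ^ Poly_Mapping.lookup (m + m') v)"
    by (rule mon_eval_superset) (auto simp: keys_add)
  also have "\<dots> = (\<Prod>v\<in>?A. \<sigma> v ^ Poly_Mapping.lookup m v) * (\<Prod>v\<in>?A. \<sigma> v ^ Poly_Mapping.lookup m' v)"
    by (simp add: lookup_add power_add prod.distrib)
  also have "\<dots> = mon_eval \<sigma> m * mon_eval \<sigma> m'"
    by (simp add: mon_eval_superset[symmetric])
  finally show ?thesis .
qed

lemma mon_eval_0 [simp]: "mon_eval \<sigma> 0 = 1"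
  by (simp add: mon_eval_def)

lemma mon_eval_Var: "mon_eval Var m = Poly_Mapping.single m 1"
proof -
  have "mon_eval Var m = (\<Prod>v\<in>Poly_Mapping.keys m. Poly_Mapping.single (Poly_Mapping.single v (Poly_Mapping.lookup m v)) (1::'a))"
  proof -
    have "(Var v :: 'a mpoly) ^ k = Poly_Mapping.single (Poly_Mapping.single v k) 1" for v k
      by (induction k) (simp_all add: Var_def mult_single single_add[symmetric])
    then show ?thesis
      by (simp add: mon_eval_def)
  qed
  also have "\<dots> = Poly_Mapping.single (\<Sum>v\<in>Poly_Mapping.keys m. Poly_Mapping.single v (Poly_Mapping.lookup m v)) 1"
  proof -
    have "finite A \<Longrightarrow> (\<Prod>v\<in>A. Poly_Mapping.single (g v) (1::'a)) = Poly_Mapping.single (sum g A) 1"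
      for A and g :: "nat \<Rightarrow> nat \<Rightarrow>\<^sub>0 nat"
      by (induction A rule: finite_induct) (simp_all add: mult_single)
    then show ?thesis
      by simp
  qed
  also have "(\<Sum>v\<in>Poly_Mapping.keys m. Poly_Mapping.single v (Poly_Mapping.lookup m v)) = m"
    by (rule poly_mapping_eqI) (simp add: lookup_sum lookup_single when_def in_keys_iff)
  finally show ?thesis .
qed

lemma mpoly_sum_monomials:
  "(\<Sum>m\<in>Poly_Mapping.keys p. Poly_Mapping.single m (Poly_Mapping.lookup p m)) = p"
  by (rule poly_mapping_eqI) (simp add: lookup_sum lookup_single when_def in_keys_iff)

lemma mp_eval_superset:
  assumes "comm_ring_hom \<iota>" "finite M" "Poly_Mapping.keys p \<subseteq> M"
  shows "mp_eval \<iota> \<sigma> p = (\<Sum>m\<in>M. \<iota> (Poly_Mapping.lookup p m) * mon_eval \<sigma> m)"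
proof -
  interpret comm_ring_hom \<iota> by fact
  show ?thesis
    unfolding mp_eval_def using assms by (intro sum.mono_neutral_left) (auto simp: in_keys_iff)
qed

lemma mp_eval_cong:
  assumes "p \<in> poly_ring V" "\<And>v. v \<in> V \<Longrightarrow> \<sigma> v = \<tau> v"
  shows "mp_eval \<iota> \<sigma> p = mp_eval \<iota> \<tau> p"
  unfolding mp_eval_def mon_eval_def
  using assms by (intro sum.cong prod.cong arg_cong2[where f = "(*)"] arg_cong2[where f = "(^)"] refl)
    (auto simp: poly_ring_def)

lemma comm_ring_hom_mp_eval:
  assumes "comm_ring_hom \<iota>"
  shows "comm_ring_hom (mp_eval \<iota> \<sigma>)"
proof -
  interpret comm_ring_hom \<iota> by fact
  have zero: "mp_eval \<iota> \<sigma> 0 = 0"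
    by (simp add: mp_eval_def)
  have add: "mp_eval \<iota> \<sigma> (p + q) = mp_eval \<iota> \<sigma> p + mp_eval \<iota> \<sigma> q" for p q
  proof -
    let ?M = "Poly_Mapping.keys p \<union> Poly_Mapping.keys q"
    have "mp_eval \<iota> \<sigma> (p + q) = (\<Sum>m\<in>?M. \<iota> (Poly_Mapping.lookup (p + q) m) * mon_eval \<sigma> m)"
      by (rule mp_eval_superset[OF assms]) (auto simp: keys_add)
    also have "\<dots> = (\<Sum>m\<in>?M. \<iota> (Poly_Mapping.lookup p m) * mon_eval \<sigma> m)
                   + (\<Sum>m\<in>?M. \<iota> (Poly_Mapping.lookup q m) * mon_eval \<sigma> m)"
      by (simp add: lookup_add hom_distribs distrib_right sum.distrib)
    also have "\<dots> = mp_eval \<iota> \<sigma> p + mp_eval \<iota> \<sigma> q"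
      by (simp add: mp_eval_superset[OF assms, symmetric])
    finally show ?thesis .
  qed
  have sum: "mp_eval \<iota> \<sigma> (sum g A) = (\<Sum>i\<in>A. mp_eval \<iota> \<sigma> (g i))"
    for A :: "(nat \<Rightarrow>\<^sub>0 nat) set" and g
    by (induction A rule: infinite_finite_induct) (simp_all add: zero add)
  have single: "mp_eval \<iota> \<sigma> (Poly_Mapping.single m c) = \<iota> c * mon_eval \<sigma> m" for m c
    using mp_eval_superset[OF assms, of "{m}" "Poly_Mapping.single m c"] by simp
  have mult: "mp_eval \<iota> \<sigma> (p * q) = mp_eval \<iota> \<sigma> p * mp_eval \<iota> \<sigma> q" for p q
  proof -
    have "p * q = (\<Sum>m\<in>Poly_Mapping.keys p. Poly_Mapping.single m (Poly_Mapping.lookup p m))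
                * (\<Sum>m\<in>Poly_Mapping.keys q. Poly_Mapping.single m (Poly_Mapping.lookup q m))"
      by (simp add: mpoly_sum_monomials)
    also have "\<dots> = (\<Sum>m\<in>Poly_Mapping.keys p. \<Sum>m'\<in>Poly_Mapping.keys q.
        Poly_Mapping.single (m + m') (Poly_Mapping.lookup p m * Poly_Mapping.lookup q m'))"
      by (simp add: sum_product mult_single)
    finally have "mp_eval \<iota> \<sigma> (p * q) = (\<Sum>m\<in>Poly_Mapping.keys p. \<Sum>m'\<in>Poly_Mapping.keys q.
        (\<iota> (Poly_Mapping.lookup p m) * mon_eval \<sigma> m) * (\<iota> (Poly_Mapping.lookup q m') * mon_eval \<sigma> m'))"
      by (simp add: sum single mon_eval_add hom_distribs mult_ac)
    then show ?thesis
      by (simp add: mp_eval_def sum_product)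
  qed
  show ?thesis
    by unfold_locales (use single[of 0 1] in \<open>simp_all add: zero add mult\<close>)
qed

lemmas mp_eval_hom = comm_ring_hom_mp_eval[OF comm_ring_hom_Const]

lemma mp_eval_single:
  assumes "comm_ring_hom \<iota>"
  shows "mp_eval \<iota> \<sigma> (Poly_Mapping.single m c) = \<iota> c * mon_eval \<sigma> m"
  using mp_eval_superset[OF assms, of "{m}" "Poly_Mapping.single m c"] by simp

lemma mp_eval_Const:
  assumes "comm_ring_hom \<iota>"
  shows "mp_eval \<iota> \<sigma> (Const c) = \<iota> c"
  using mp_eval_single[OF assms, of \<sigma> 0 c] by simp

lemma mp_eval_Var:
  assumes "comm_ring_hom \<iota>"
  shows "mp_eval \<iota> \<sigma> (Var v) = \<sigma> v"
proof -
  interpret comm_ring_hom \<iota> by fact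
  show ?thesis
    using mp_eval_single[OF assms, of \<sigma> "Poly_Mapping.single v 1" 1] by (simp add: Var_def mon_eval_def)
qed

text \<open>Uniqueness in the universal property of the polynomial ring. It identifies composites of
  evaluations without expanding them.\<close>

lemma hom_eq_mp_eval:
  assumes "comm_ring_hom h"
  shows "h p = mp_eval (\<lambda>c. h (Const c)) (\<lambda>v. h (Var v)) p"
proof -
  interpret comm_ring_hom h by fact
  have "p = (\<Sum>m\<in>Poly_Mapping.keys p. Const (Poly_Mapping.lookup p m) * mon_eval Var m)"
    by (simp add: mon_eval_Var mult_single mpoly_sum_monomials)
  then have "h p = h (\<Sum>m\<in>Poly_Mapping.keys p. Const (Poly_Mapping.lookup p m) * mon_eval Var m)"
    by (rule arg_cong)
  then show ?thesis
    by (simp add: hom_distribs mp_eval_def mon_eval_def)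
qed

lemma comm_ring_hom_comp:
  assumes "comm_ring_hom g" "comm_ring_hom h"
  shows "comm_ring_hom (\<lambda>x. g (h x))"
proof -
  interpret g: comm_ring_hom g by fact
  interpret h: comm_ring_hom h by fact
  show ?thesis
    by unfold_locales (simp_all add: hom_distribs)
qed

lemma mp_eval_Const_Var: "mp_eval Const Var p = p"
  by (simp add: mp_eval_def mon_eval_Var mult_single mpoly_sum_monomials)

lemma mp_eval_congruence:
  assumes "is_ideal I" "p \<in> poly_ring V" "\<And>v. v \<in> V \<Longrightarrow> \<sigma> v - \<tau> v \<in> I"
  shows "mp_eval \<iota> \<sigma> p - mp_eval \<iota> \<tau> p \<in> I"
  unfolding mp_eval_def mon_eval_def sum_subtractf[symmetric] right_diff_distrib[symmetric]
  using assms(2,3)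
  by (intro ideal_sum ideal_mult_left ideal_congruence_prod ideal_congruence_power assms(1))
     (auto simp: poly_ring_def)

lemma mon_eval_scale: "mon_eval (\<lambda>v. u * \<sigma> v) m = u ^ mdeg UNIV m * mon_eval \<sigma> m"
  by (simp add: mon_eval_def power_mult_distrib prod.distrib mdeg_def power_sum)

lemma mp_eval_scale:
  assumes "homogeneous s p"
  shows "mp_eval \<iota> (\<lambda>v. u * \<sigma> v) p = u ^ s * mp_eval \<iota> \<sigma> p"
  unfolding mp_eval_def sum_distrib_left
  using assms by (intro sum.cong refl) (auto simp: mon_eval_scale homogeneous_def)

lemma degree_mp_eval_le:
  fixes \<sigma> :: "nat \<Rightarrow> 'a::comm_ring_1 poly"
  assumes "homogeneous s p" "\<And>v. degree (\<sigma> v) \<le> 1"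
  shows "degree (mp_eval (\<lambda>c. [:\<iota> c:]) \<sigma> p) \<le> s"
  unfolding mp_eval_def
proof (rule degree_sum_le)
  fix m assume m: "m \<in> Poly_Mapping.keys p"
  have "degree (mon_eval \<sigma> m) \<le> (\<Sum>v\<in>Poly_Mapping.keys m. degree (\<sigma> v ^ Poly_Mapping.lookup m v))"
    unfolding mon_eval_def using degree_prod_sum_le[OF finite_keys] by (simp add: o_def)
  also have "\<dots> \<le> (\<Sum>v\<in>Poly_Mapping.keys m. Poly_Mapping.lookup m v)"
  proof (rule sum_mono)
    fix v
    have "degree (\<sigma> v ^ Poly_Mapping.lookup m v) \<le> degree (\<sigma> v) * Poly_Mapping.lookup m v"
      by (rule degree_power_le)
    also have "\<dots> \<le> Poly_Mapping.lookup m v"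
      using assms(2)[of v] by (cases "degree (\<sigma> v) = 0") auto
    finally show "degree (\<sigma> v ^ Poly_Mapping.lookup m v) \<le> Poly_Mapping.lookup m v" .
  qed
  also have "\<dots> = s"
    using assms(1) m by (simp add: homogeneous_def mdeg_def)
  finally show "degree ([:\<iota> (Poly_Mapping.lookup p m):] * mon_eval \<sigma> m) \<le> s"
    using degree_mult_le[of "[:\<iota> (Poly_Mapping.lookup p m):]" "mon_eval \<sigma> m"] by simp
qed simp

subsection \<open>Subrings on fewer variables\<close>

text \<open>Setting the variables outside \<open>V\<close> to zero is a ring retraction onto
  \<open>poly_ring V\<close>. Membership becomes a fixed point equation, and closure properties
  follow from the homomorphism laws.\<close>

definition retract :: "nat set \<Rightarrow> 'k::comm_ring_1 mpoly \<Rightarrow> 'k mpoly" where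
  "retract V = mp_eval Const (\<lambda>v. if v \<in> V then Var v else 0)"

lemma comm_ring_hom_retract: "comm_ring_hom (retract V)"
  unfolding retract_def by (rule mp_eval_hom)

lemma retract_in_poly_ring: "retract V p \<in> poly_ring V"
proof -
  have mon: "mon_eval (\<lambda>v. if v \<in> V then Var v else 0 :: 'a mpoly) m
      = (if Poly_Mapping.keys m \<subseteq> V then Poly_Mapping.single m 1 else 0)" for m
  proof (cases "Poly_Mapping.keys m \<subseteq> V")
    case True
    then have "mon_eval (\<lambda>v. if v \<in> V then Var v else 0 :: 'a mpoly) m = mon_eval Var m"
      unfolding mon_eval_def by (intro prod.cong) auto
    then show ?thesis
      using True by (simp add: mon_eval_Var)
  next
    case False
    then obtain v where "v \<in> Poly_Mapping.keys m" "v \<notin> V"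
      by auto
    then have "\<exists>v\<in>Poly_Mapping.keys m. (if v \<in> V then Var v else 0 :: 'a mpoly) ^ Poly_Mapping.lookup m v = 0"
      by (intro bexI[of _ v]) (auto simp: in_keys_iff power_0_left)
    then show ?thesis
      using False by (auto simp: mon_eval_def intro!: prod_zero)
  qed
  show ?thesis
    unfolding poly_ring_def retract_def mp_eval_def mon
    using keys_sum[of "\<lambda>m. Const (Poly_Mapping.lookup p m) *
       (if Poly_Mapping.keys m \<subseteq> V then Poly_Mapping.single m 1 else 0)" "Poly_Mapping.keys p"]
    by (fastforce simp: mult_single split: if_splits)
qed

lemma poly_ring_iff_retract: "p \<in> poly_ring V \<longleftrightarrow> retract V p = p"
proof
  assume "p \<in> poly_ring V"
  then have "retract V p = mp_eval Const Var p"
    unfolding retract_def by (rule mp_eval_cong) simp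
  then show "retract V p = p"
    by (simp add: mp_eval_Const_Var)
qed (metis retract_in_poly_ring)

lemma
  shows poly_ring_uminus: "p \<in> poly_ring V \<Longrightarrow> - p \<in> poly_ring V"
    and poly_ring_mult: "p \<in> poly_ring V \<Longrightarrow> q \<in> poly_ring V \<Longrightarrow> p * q \<in> poly_ring V"
    and poly_ring_0: "0 \<in> poly_ring V"
    and poly_ring_1: "1 \<in> poly_ring V"
    and poly_ring_sum: "(\<And>i. i \<in> A \<Longrightarrow> g i \<in> poly_ring V) \<Longrightarrow> sum g A \<in> poly_ring V"
proof -
  interpret comm_ring_hom "retract V"
    by (rule comm_ring_hom_retract)
  show "p \<in> poly_ring V \<Longrightarrow> - p \<in> poly_ring V"
    "p \<in> poly_ring V \<Longrightarrow> q \<in> poly_ring V \<Longrightarrow> p * q \<in> poly_ring V"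
    "0 \<in> poly_ring V" "1 \<in> poly_ring V"
    "(\<And>i. i \<in> A \<Longrightarrow> g i \<in> poly_ring V) \<Longrightarrow> sum g A \<in> poly_ring V"
    unfolding poly_ring_iff_retract by (simp_all add: hom_distribs)
qed

lemma Var_in_poly_ring: "v \<in> V \<Longrightarrow> Var v \<in> poly_ring V"
  by (auto simp: poly_ring_def Var_def)

lemma gen_ideal_subset_ideal_span: "gen_ideal V G \<subseteq> ideal_span G"
  unfolding gen_ideal_def ideal_span_explicit by blast

lemma gen_ideal_base: "g \<in> G \<Longrightarrow> g \<in> gen_ideal V G"
  unfolding gen_ideal_def
  by (intro CollectI exI[of _ "{g}"] exI[of _ "\<lambda>_. 1"]) (auto simp: poly_ring_1)

text \<open>Retracting the coefficients of a combination of \<open>G\<close> moves them into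
  \<open>poly_ring V\<close>: extending an ideal to more variables and contracting it again changes
  nothing.\<close>

lemma gen_ideal_eq_ideal_span:
  assumes "G \<subseteq> poly_ring V"
  shows "gen_ideal V G = ideal_span G \<inter> poly_ring V"
proof (intro equalityI subsetI IntI)
  fix p assume "p \<in> gen_ideal V G"
  then show "p \<in> ideal_span G" "p \<in> poly_ring V"
    using subsetD[OF gen_ideal_subset_ideal_span] assms
    by (blast, auto simp: gen_ideal_def intro!: poly_ring_sum poly_ring_mult)
next
  fix p assume p: "p \<in> ideal_span G \<inter> poly_ring V"
  then obtain F c where F: "finite F" "F \<subseteq> G" "p = (\<Sum>g\<in>F. c g * g)"
    by (auto simp: ideal_span_explicit)
  interpret comm_ring_hom "retract V"
    by (rule comm_ring_hom_retract)
  have "p = retract V p"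
    using p by (simp add: poly_ring_iff_retract)
  also have "\<dots> = (\<Sum>g\<in>F. retract V (c g) * g)"
    using F(2) assms unfolding F(3)
    by (auto simp: hom_distribs poly_ring_iff_retract subset_iff intro!: sum.cong)
  finally show "p \<in> gen_ideal V G"
    unfolding gen_ideal_def using F(1,2) retract_in_poly_ring
    by (intro CollectI exI[of _ F] exI[of _ "\<lambda>g. retract V (c g)"]) auto
qed

text \<open>The coefficients are indexed by \<open>A\<close> and not by the image, since the
  generators of \<open>I\<close> may contain repetitions.\<close>

lemma ideal_span_image_finite:
  assumes "finite A" "x \<in> ideal_span (g ` A)"
  shows "\<exists>c. x = (\<Sum>i\<in>A. c i * g i)"
proof -
  let ?I = "{x. \<exists>c. x = (\<Sum>i\<in>A. c i * g i)}"
  have "is_ideal ?I"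
  proof (rule is_idealI)
    show "0 \<in> ?I"
      by (auto intro!: exI[of _ "\<lambda>_. 0"])
  next
    fix x y assume "x \<in> ?I" "y \<in> ?I"
    then obtain c c' where "x = (\<Sum>i\<in>A. c i * g i)" "y = (\<Sum>i\<in>A. c' i * g i)"
      by auto
    then show "x + y \<in> ?I"
      by (auto intro!: exI[of _ "\<lambda>i. c i + c' i"] simp: distrib_right sum.distrib)
  next
    fix a x assume "x \<in> ?I"
    then obtain c where "x = (\<Sum>i\<in>A. c i * g i)"
      by auto
    then show "a * x \<in> ?I"
      by (auto intro!: exI[of _ "\<lambda>i. a * c i"] simp: sum_distrib_left mult.assoc)
  qed
  moreover have "g ` A \<subseteq> ?I"
  proof
    fix y assume "y \<in> g ` A"
    then obtain j where j: "j \<in> A" "y = g j"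
      by auto
    then have "y = (\<Sum>i\<in>A. (if i = j then 1 else 0) * g i)"
      using assms(1) by (simp add: if_distrib[where f = "\<lambda>c. c * g _"] cong: if_cong)
    then show "y \<in> ?I"
      by (intro CollectI exI)
  qed
  ultimately show ?thesis
    using ideal_span_minimal[of "g ` A" ?I] assms(2) by auto
qed

subsection \<open>Homogeneous components\<close>

lemma comm_ring_hom_pCons: "comm_ring_hom (\<lambda>c :: 'a::comm_ring_1. [:c:])"
  by unfold_locales simp_all

lemma mp_eval_pCons:
  assumes "comm_ring_hom \<iota>"
  shows "mp_eval (\<lambda>c. [:\<iota> c:]) (\<lambda>v. [:\<sigma> v:]) p = [:mp_eval \<iota> \<sigma> p:]"
  using hom_eq_mp_eval[OF comm_ring_hom_comp[OF comm_ring_hom_pCons comm_ring_hom_mp_eval[OF assms, of \<sigma>]], of p]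
  by (simp add: mp_eval_Const[OF assms] mp_eval_Var[OF assms])

text \<open>The coefficient of \<open>t ^ s\<close> in \<open>grade p\<close> is the homogeneous component of degree \<open>s\<close>.\<close>

definition grade :: "'k::comm_ring_1 mpoly \<Rightarrow> 'k mpoly poly" where
  "grade = mp_eval (\<lambda>c. [:Const c:]) (\<lambda>v. monom 1 1 * [:Var v:])"

lemmas comm_ring_hom_pCons_Const = comm_ring_hom_comp[OF comm_ring_hom_pCons comm_ring_hom_Const]

lemma comm_ring_hom_grade: "comm_ring_hom grade"
  unfolding grade_def by (rule comm_ring_hom_mp_eval[OF comm_ring_hom_pCons_Const])

lemma grade_homogeneous:
  assumes "homogeneous s p"
  shows "grade p = monom p s"
  unfolding grade_def mp_eval_scale[OF assms] mp_eval_pCons[OF comm_ring_hom_Const] mp_eval_Const_Var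
  by (simp add: monom_power smult_monom[symmetric] mult.commute[of _ "[:_:]"] smult_monom)

lemma coeff_grade:
  "coeff (grade p) s = (\<Sum>m\<in>Poly_Mapping.keys p.
     if mdeg UNIV m = s then Poly_Mapping.single m (Poly_Mapping.lookup p m) else 0)"
proof -
  interpret grade: comm_ring_hom grade
    by (rule comm_ring_hom_grade)
  have "grade p = (\<Sum>m\<in>Poly_Mapping.keys p. grade (Poly_Mapping.single m (Poly_Mapping.lookup p m)))"
    by (subst mpoly_sum_monomials[of p, symmetric]) (rule grade.hom_sum)
  also have "\<dots> = (\<Sum>m\<in>Poly_Mapping.keys p. monom (Poly_Mapping.single m (Poly_Mapping.lookup p m)) (mdeg UNIV m))"
    by (intro sum.cong refl grade_homogeneous) (simp add: homogeneous_def)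
  finally show ?thesis
    by (simp add: coeff_sum eq_commute)
qed

lemma keys_coeff_grade: "Poly_Mapping.keys (coeff (grade p) s) \<subseteq> {m \<in> Poly_Mapping.keys p. mdeg UNIV m = s}"
  unfolding coeff_grade
  using keys_sum[of "\<lambda>m. if mdeg UNIV m = s then Poly_Mapping.single m (Poly_Mapping.lookup p m) else 0" "Poly_Mapping.keys p"]
  by (fastforce split: if_splits)

lemma homogeneous_coeff_grade: "homogeneous s (coeff (grade p) s)"
  using keys_coeff_grade[of p s] by (auto simp: homogeneous_def)

lemma coeff_grade_in_poly_ring: "p \<in> poly_ring V \<Longrightarrow> coeff (grade p) s \<in> poly_ring V"
  using keys_coeff_grade[of p s] by (auto simp: poly_ring_def)

text \<open>Setting \<open>t = 1\<close> in \<open>grade p\<close> gives back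
  \<open>p\<close>.\<close>

lemma sum_coeff_grade: "(\<Sum>s\<le>degree (grade p). coeff (grade p) s) = p"
proof -
  have eval: "comm_ring_hom (\<lambda>q. poly (grade q) (1 :: 'a mpoly))"
    by (rule comm_ring_hom_comp[OF _ comm_ring_hom_grade, of "\<lambda>q. poly q 1"]) (unfold_locales, simp_all)
  have "poly (grade p) 1 = p"
    using hom_eq_mp_eval[OF eval, of p]
    by (simp add: grade_def mp_eval_Const mp_eval_Var comm_ring_hom_pCons_Const poly_monom mp_eval_Const_Var)
  then show ?thesis
    by (simp add: poly_altdef)
qed

text \<open>The substitution multiplies degrees by \<open>d\<close>, and as \<open>d > 0\<close> the
  images of distinct components have distinct degrees and cannot cancel. Hence \<open>I(W)\<close>
  is homogeneous.\<close>

lemma mp_eval_component_eq_0: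
  assumes "p \<in> poly_ring V" "\<And>v. v \<in> V \<Longrightarrow> homogeneous d (\<sigma> v)" "d > 0" "mp_eval Const \<sigma> p = 0"
  shows "mp_eval Const \<sigma> (coeff (grade p) s) = 0"
proof -
  let ?E = "mp_eval Const \<sigma>" and ?D = "degree (grade p)"
  interpret E: comm_ring_hom ?E by (rule mp_eval_hom)
  interpret grade: comm_ring_hom grade by (rule comm_ring_hom_grade)
  have component: "grade (?E (coeff (grade p) i)) = monom (?E (coeff (grade p) i)) (d * i)" for i
  proof -
    let ?q = "coeff (grade p) i"
    have "grade (?E ?q) = mp_eval (\<lambda>c. [:Const c:]) (\<lambda>v. grade (\<sigma> v)) ?q"
      using hom_eq_mp_eval[OF comm_ring_hom_comp[OF comm_ring_hom_grade mp_eval_hom[of \<sigma>]], of ?q]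
      by (simp add: mp_eval_Const mp_eval_Var comm_ring_hom_Const comm_ring_hom_pCons_Const grade_def)
    also have "\<dots> = mp_eval (\<lambda>c. [:Const c:]) (\<lambda>v. monom 1 d * [:\<sigma> v:]) ?q"
      using assms(2)
      by (intro mp_eval_cong[OF coeff_grade_in_poly_ring[OF assms(1)]])
         (simp add: grade_homogeneous mult.commute[of _ "[:_:]"] smult_monom)
    also have "\<dots> = monom (?E ?q) (d * i)"
      unfolding mp_eval_scale[OF homogeneous_coeff_grade] mp_eval_pCons[OF comm_ring_hom_Const]
      by (simp add: monom_power mult.commute[of _ "[:_:]"] smult_monom mult.commute)
    finally show ?thesis .
  qed
  show ?thesis
  proof (cases "s \<le> ?D")
    case True
    have "0 = grade (?E (\<Sum>i\<le>?D. coeff (grade p) i))"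
      using assms(4) by (simp add: sum_coeff_grade)
    also have "\<dots> = (\<Sum>i\<le>?D. monom (?E (coeff (grade p) i)) (d * i))"
      by (simp only: E.hom_sum grade.hom_sum component)
    finally have "0 = coeff (\<Sum>i\<le>?D. monom (?E (coeff (grade p) i)) (d * i)) (d * s)"
      by simp
    also have "\<dots> = ?E (coeff (grade p) s)"
      using True assms(3) by (simp add: coeff_sum)
    finally show ?thesis by simp
  next
    case False
    then show ?thesis
      by (simp add: coeff_eq_0)
  qed
qed

subsection \<open>Minors\<close>

text \<open>The index functions need not be injective or increasing.\<close>

definition minor :: "(nat \<Rightarrow> nat \<Rightarrow> 'a::comm_ring_1) \<Rightarrow> nat \<Rightarrow> (nat \<Rightarrow> nat) \<Rightarrow> (nat \<Rightarrow> nat) \<Rightarrow> 'a" where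
  "minor M e \<rho> \<gamma> = det (mat e e (\<lambda>(i, j). M (\<rho> i) (\<gamma> j)))"

definition minors :: "nat \<Rightarrow> nat \<Rightarrow> (nat \<Rightarrow> nat \<Rightarrow> 'a::comm_ring_1) \<Rightarrow> nat \<Rightarrow> 'a set" where
  "minors N n M e = {minor M e \<rho> \<gamma> | \<rho> \<gamma>. \<rho> ` {..<e} \<subseteq> {..<N} \<and> \<gamma> ` {..<e} \<subseteq> {..<n}}"

lemma det_fun_eq_minor: "det_fun n (\<lambda>i. M (\<rho> i)) = minor M n \<rho> (\<lambda>j. j)"
proof -
  have "(\<Prod>i<n. M (\<rho> i) (p i)) = (\<Prod>i = 0..<n. mat n n (\<lambda>(i, j). M (\<rho> i) j) $$ (i, p i))"
    if "p permutes {..<n}" for p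
    using that permutes_in_image[OF that]
    by (intro prod.cong) (auto simp: atLeast0LessThan)
  then show ?thesis
    by (simp add: det_fun_def minor_def det_def'[OF mat_carrier] atLeast0LessThan)
qed

text \<open>The vector \<open>w\<close> consists of the cofactors along the last row of a bordered
  matrix. They do not depend on that row, so Laplace expansion gives the product of \<open>w\<close>
  with every row \<open>j\<close> at once.\<close>

lemma minor_kernel_vector:
  fixes M :: "nat \<Rightarrow> nat \<Rightarrow> 'a::comm_ring_1"
  assumes "\<gamma> ` {..<e} \<subseteq> {..<n}" "c < n" "c \<notin> \<gamma> ` {..<e}"
  shows "\<exists>w. w c = minor M e \<rho> \<gamma> \<and> (\<forall>c'. c' \<noteq> c \<longrightarrow> c' \<notin> \<gamma> ` {..<e} \<longrightarrow> w c' = 0)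
    \<and> (\<forall>j. (\<Sum>l<n. M j l * w l) = minor M (Suc e) (\<rho>(e := j)) (\<gamma>(e := c)))"
proof -
  define \<gamma>' where "\<gamma>' = \<gamma>(e := c)"
  define A where "A j = mat (Suc e) (Suc e) (\<lambda>(i, t). M ((\<rho>(e := j)) i) (\<gamma>' t))" for j
  have A: "A j \<in> carrier_mat (Suc e) (Suc e)" for j
    by (simp add: A_def)
  have cofactor_A: "cofactor (A j) e t = cofactor (A 0) e t" for j t
  proof -
    have "mat_delete (A j) e t = mat_delete (A 0) e t"
      by (rule eq_matI) (auto simp: mat_delete_def A_def)
    then show ?thesis
      by (simp add: cofactor_def)
  qed
  have "mat_delete (A 0) e e = mat e e (\<lambda>(i, j). M (\<rho> i) (\<gamma> j))"
    by (rule eq_matI) (auto simp: mat_delete_def A_def \<gamma>'_def)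
  then have cofactor_e: "cofactor (A 0) e e = minor M e \<rho> \<gamma>"
    by (simp add: cofactor_def minor_def)
  \<comment> \<open>Several positions \<open>t\<close> may carry the same column \<open>l\<close>,
    because \<open>\<gamma>\<close> need not be injective; their cofactors are added.\<close>
  define w where "w l = (\<Sum>t | t < Suc e \<and> \<gamma>' t = l. cofactor (A 0) e t)" for l
  show ?thesis
  proof (intro exI[of _ w] conjI allI impI)
    have "{t. t < Suc e \<and> \<gamma>' t = c} = {e}"
      using assms(3) by (auto simp: \<gamma>'_def less_Suc_eq)
    then show "w c = minor M e \<rho> \<gamma>"
      by (simp add: w_def cofactor_e)
  next
    fix c' assume "c' \<noteq> c" "c' \<notin> \<gamma> ` {..<e}"
    then have "{t. t < Suc e \<and> \<gamma>' t = c'} = {}"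
      by (auto simp: \<gamma>'_def less_Suc_eq)
    then show "w c' = 0"
      by (simp only: w_def sum.empty)
  next
    fix j
    have \<gamma>': "\<gamma>' ` {..<Suc e} \<subseteq> {..<n}"
      using assms(1,2) by (auto simp: \<gamma>'_def less_Suc_eq image_subset_iff)
    have "(\<Sum>l<n. M j l * w l) = (\<Sum>l<n. \<Sum>t\<in>{t \<in> {..<Suc e}. \<gamma>' t = l}. M j (\<gamma>' t) * cofactor (A 0) e t)"
      by (auto simp: w_def sum_distrib_left intro!: sum.cong)
    also have "\<dots> = (\<Sum>t<Suc e. M j (\<gamma>' t) * cofactor (A 0) e t)"
      by (rule sum.group[OF _ _ \<gamma>']) auto
    also have "\<dots> = (\<Sum>t<Suc e. A j $$ (e, t) * cofactor (A j) e t)"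
      by (intro sum.cong refl) (simp add: cofactor_A[of j], simp add: A_def)
    also have "\<dots> = det (A j)"
      by (rule laplace_expansion_row[OF A, symmetric]) simp
    finally show "(\<Sum>l<n. M j l * w l) = minor M (Suc e) (\<rho>(e := j)) (\<gamma>(e := c))"
      by (simp add: minor_def A_def \<gamma>'_def)
  qed
qed

lemma minor_in_minors_Suc:
  assumes "\<rho> ` {..<e} \<subseteq> {..<N}" "j < N" "\<gamma> ` {..<e} \<subseteq> {..<n}" "c < n"
  shows "minor M (Suc e) (\<rho>(e := j)) (\<gamma>(e := c)) \<in> minors N n M (Suc e)"
proof -
  have "(\<rho>(e := j)) ` {..<Suc e} \<subseteq> {..<N}" "(\<gamma>(e := c)) ` {..<Suc e} \<subseteq> {..<n}"
    using assms by (auto simp: less_Suc_eq image_subset_iff)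
  then show ?thesis
    unfolding minors_def by blast
qed

text \<open>Selecting columns is multiplication on the right by a 0/1 matrix, whose determinant is
  the quotient; selecting rows below is multiplication on the left.\<close>

lemma minor_dvd_columns:
  assumes "\<gamma> ` {..<n} \<subseteq> {..<n}"
  shows "minor M n \<rho> (\<lambda>j. j) dvd minor M n \<rho> \<gamma>"
proof -
  let ?A = "mat n n (\<lambda>(i, j). M (\<rho> i) j)" and ?E = "mat n n (\<lambda>(l, j). if l = \<gamma> j then 1 else 0)"
  have "mat n n (\<lambda>(i, j). M (\<rho> i) (\<gamma> j)) = ?A * ?E"
    using assms by (intro eq_matI) (auto simp: scalar_prod_def if_distrib cong: if_cong)
  then show ?thesis
    unfolding minor_def by (simp add: det_mult[of _ n])
qed

lemma minor_dvd_rows: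
  assumes "\<pi> ` {..<n} \<subseteq> {..<n}" "\<And>i. i < n \<Longrightarrow> \<rho> i = \<rho>' (\<pi> i)"
  shows "minor M n \<rho>' \<gamma> dvd minor M n \<rho> \<gamma>"
proof -
  let ?A = "mat n n (\<lambda>(i, j). M (\<rho>' i) (\<gamma> j))" and ?E = "mat n n (\<lambda>(i, l). if l = \<pi> i then 1 else 0)"
  have "mat n n (\<lambda>(i, j). M (\<rho> i) (\<gamma> j)) = ?E * ?A"
    using assms
    by (intro eq_matI) (auto simp: scalar_prod_def if_distrib[where f = "\<lambda>c. c * _"] cong: if_cong)
  then show ?thesis
    unfolding minor_def by (simp add: det_mult[of _ n])
qed

text \<open>An arbitrary choice of \<open>n\<close> rows either repeats a row, giving determinant
  zero, or rearranges an increasing choice.\<close>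

lemma minors_subset_ideal_span_maximal_minors:
  "minors N n M n \<subseteq> ideal_span (maximal_minors N n M)"
proof
  fix d assume "d \<in> minors N n M n"
  then obtain \<rho> \<gamma> where d: "d = minor M n \<rho> \<gamma>"
    and \<rho>: "\<rho> ` {..<n} \<subseteq> {..<N}" and \<gamma>: "\<gamma> ` {..<n} \<subseteq> {..<n}"
    by (auto simp: minors_def)
  show "d \<in> ideal_span (maximal_minors N n M)"
  proof (cases "inj_on \<rho> {..<n}")
    case False
    then obtain i j where "i < n" "j < n" "i \<noteq> j" "\<rho> i = \<rho> j"
      by (auto simp: inj_on_def)
    then have "d = 0"
      unfolding d minor_def by (intro det_identical_rows[of _ n i j]) auto
    then show ?thesis
      using ideal_0[OF is_ideal_span] by simp
  next
    case True
    define xs where "xs = sorted_list_of_set (\<rho> ` {..<n})"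
    have set_xs: "set xs = \<rho> ` {..<n}" and len: "length xs = n"
      using True by (simp_all add: xs_def card_image)
    have "\<exists>k<n. \<rho> i = xs ! k" if "i < n" for i
      using that set_xs len by (metis image_eqI in_set_conv_nth lessThan_iff)
    then obtain \<pi> where \<pi>: "\<And>i. i < n \<Longrightarrow> \<pi> i < n \<and> \<rho> i = xs ! \<pi> i"
      by metis
    have "strict_mono_on {..<n} ((!) xs)"
      using len strict_sorted_list_of_set[of "\<rho> ` {..<n}"]
      by (auto simp: strict_mono_on_def xs_def sorted_wrt_iff_nth_less)
    moreover have "(!) xs ` {..<n} \<subseteq> {..<N}"
      using \<rho> set_xs len by (metis image_subsetI lessThan_iff nth_mem subsetD)
    ultimately have "minor M n ((!) xs) (\<lambda>j. j) \<in> maximal_minors N n M"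
      unfolding maximal_minors_def det_fun_eq_minor[symmetric] by blast
    moreover have "minor M n ((!) xs) (\<lambda>j. j) dvd d"
      unfolding d using \<pi> \<gamma> by (intro dvd_trans[OF minor_dvd_rows[of \<pi>] minor_dvd_columns]) auto
    ultimately show ?thesis
      by (metis dvd_def ideal_mult_right ideal_span_base is_ideal_span)
  qed
qed

text \<open>Multiplying \<open>A v = 0\<close> by the adjugate gives \<open>det A\<close> times
  \<open>v\<close>; no division is involved.\<close>

lemma det_fun_mult_kernel:
  fixes M :: "nat \<Rightarrow> nat \<Rightarrow> 'a::comm_ring_1"
  assumes "\<And>i. i < n \<Longrightarrow> (\<Sum>l<n. M i l * x l) = 0" "c < n"
  shows "det_fun n M * x c = 0"
proof -
  define A where "A = mat n n (\<lambda>(i, j). M i j)"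
  define v where "v = vec n x"
  have A: "A \<in> carrier_mat n n" and v: "v \<in> carrier_vec n"
    by (simp_all add: A_def v_def)
  have Av: "A *\<^sub>v v = 0\<^sub>v n"
    using assms(1) by (intro eq_vecI) (auto simp: A_def v_def scalar_prod_def atLeast0LessThan)
  have "det A \<cdot>\<^sub>v v = (det A \<cdot>\<^sub>m 1\<^sub>m n) *\<^sub>v v"
    by (intro eq_vecI) (auto simp: v_def scalar_prod_def if_distrib[where f = "\<lambda>c. c * _"]
        if_distrib[where f = "(*) _"] cong: if_cong)
  also have "\<dots> = adj_mat A *\<^sub>v (A *\<^sub>v v)"
    using assoc_mult_mat_vec[OF adj_mat(1)[OF A] A v] adj_mat(3)[OF A] by simp
  also have "\<dots> = 0\<^sub>v n"
    unfolding Av using adj_mat(1)[OF A] by auto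
  finally have "(det A \<cdot>\<^sub>v v) $ c = 0"
    using assms(2) by simp
  moreover have "det_fun n M = det A"
    using det_fun_eq_minor[of n M "\<lambda>i. i"] by (simp add: minor_def A_def)
  ultimately show ?thesis
    using assms(2) by (simp add: v_def)
qed

subsection \<open>Powers of ideals\<close>

lemma ideal_pow_subset_poly_ring:
  assumes "X \<subseteq> poly_ring V"
  shows "ideal_pow V X k \<subseteq> poly_ring V"
proof (induction k)
  case (Suc k)
  then have "{a * b | a b. a \<in> X \<and> b \<in> ideal_pow V X k} \<subseteq> poly_ring V"
    using assms by (auto intro!: poly_ring_mult)
  then show ?case
    by (simp add: gen_ideal_eq_ideal_span)
qed simp

lemma power_in_ideal_pow: "x \<in> X \<Longrightarrow> x ^ k \<in> ideal_pow V X k"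
  by (induction k) (auto intro!: gen_ideal_base simp: poly_ring_1)

lemma ideal_pow_subset_ideal_span_monomials:
  assumes "finite X"
  shows "ideal_pow V X k \<subseteq> ideal_span {\<Prod>x\<in>X. x ^ \<alpha> x | \<alpha>. (\<Sum>x\<in>X. \<alpha> x) = k}"
proof (induction k)
  case 0
  have "1 \<in> {\<Prod>x\<in>X. x ^ \<alpha> x | \<alpha>. (\<Sum>x\<in>X. \<alpha> x) = 0}"
    by (intro CollectI exI[of _ "\<lambda>_. 0"]) auto
  then have "a * 1 \<in> ideal_span {\<Prod>x\<in>X. x ^ \<alpha> x | \<alpha>. (\<Sum>x\<in>X. \<alpha> x) = 0}" for a
    by (intro ideal_mult_left is_ideal_span ideal_span_base)
  then show ?case
    by auto
next
  case (Suc k)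
  let ?G = "\<lambda>k. {\<Prod>x\<in>X. x ^ \<alpha> x | \<alpha>. (\<Sum>x\<in>X. \<alpha> x) = k}"
  have "b * a \<in> ideal_span (?G (Suc k))" if a: "a \<in> X" and b: "b \<in> ideal_pow V X k" for a b
  proof -
    have "?G k \<subseteq> {b. b * a \<in> ideal_span (?G (Suc k))}"
    proof safe
      fix \<alpha> :: "_ \<Rightarrow> nat"
      define \<beta> where "\<beta> = \<alpha>(a := Suc (\<alpha> a))"
      have "(\<Prod>x\<in>X. x ^ \<beta> x) = (\<Prod>x\<in>X. x ^ \<alpha> x) * a" "(\<Sum>x\<in>X. \<beta> x) = Suc (\<Sum>x\<in>X. \<alpha> x)"
        using a assms by (auto simp: \<beta>_def prod.remove[of X a] sum.remove[of X a] mult_ac)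
      then have "(\<Prod>x\<in>X. x ^ \<alpha> x) * a \<in> ?G (Suc (\<Sum>x\<in>X. \<alpha> x))"
        by (metis (mono_tags, lifting) mem_Collect_eq)
      then show "(\<Prod>x\<in>X. x ^ \<alpha> x) * a \<in> ideal_span (?G (Suc (\<Sum>x\<in>X. \<alpha> x)))"
        by (rule ideal_span_base)
    qed
    then have "ideal_span (?G k) \<subseteq> {b. b * a \<in> ideal_span (?G (Suc k))}"
      by (intro ideal_span_minimal is_ideal_colon is_ideal_span)
    then show ?thesis
      using Suc b by blast
  qed
  then have "{a * b | a b. a \<in> X \<and> b \<in> ideal_pow V X k} \<subseteq> ideal_span (?G (Suc k))"
    by (auto simp: mult.commute)
  then have "ideal_span {a * b | a b. a \<in> X \<and> b \<in> ideal_pow V X k} \<subseteq> ideal_span (?G (Suc k))"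
    by (intro ideal_span_minimal is_ideal_span)
  then show ?case
    using gen_ideal_subset_ideal_span unfolding ideal_pow.simps by blast
qed

text \<open>Pigeonhole: in a monomial whose degree exceeds the sum of the exponents
  \<open>M x\<close>, some \<open>x\<close> occurs at least \<open>M x\<close> times.\<close>

lemma ideal_pow_subset_ideal:
  assumes X: "finite X" and I: "is_ideal I" and "X \<subseteq> ideal_rad I"
  shows "\<exists>k. ideal_pow V X k \<subseteq> I"
proof -
  obtain M where M: "\<And>x. x \<in> X \<Longrightarrow> x ^ M x \<in> I"
    using assms(3) unfolding ideal_rad_def subset_iff mem_Collect_eq by metis
  let ?k = "Suc (sum M X)"
  have "(\<Prod>x\<in>X. x ^ \<alpha> x) \<in> I" if "(\<Sum>x\<in>X. \<alpha> x) = ?k" for \<alpha>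
  proof -
    have "\<exists>x\<in>X. M x \<le> \<alpha> x"
    proof (rule ccontr)
      assume "\<not> ?thesis"
      then have "sum \<alpha> X \<le> sum M X"
        by (intro sum_mono) (auto simp: not_le less_imp_le)
      then show False
        using that by simp
    qed
    then obtain x where x: "x \<in> X" "M x \<le> \<alpha> x"
      by blast
    then have "x ^ \<alpha> x \<in> I"
      using ideal_power_mono[OF I M] by blast
    then show ?thesis
      using x X I by (simp add: prod.remove ideal_mult_right)
  qed
  then have "ideal_span {\<Prod>x\<in>X. x ^ \<alpha> x | \<alpha>. (\<Sum>x\<in>X. \<alpha> x) = ?k} \<subseteq> I"
    by (intro ideal_span_minimal I) auto
  then show ?thesis
    using ideal_pow_subset_ideal_span_monomials[OF X] by blast
qed

subsection \<open>The Jacobian dual of a linearly presented ideal\<close>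

locale jacobian_dual =
  fixes n r N :: nat
    and f :: "nat \<Rightarrow> 'k::field mpoly"
    and L :: "nat \<Rightarrow> 'k mpoly"
    and \<Theta> :: "nat \<Rightarrow> nat \<Rightarrow> 'k mpoly"
  assumes n_pos: "n \<ge> 1"
    and f_in_S: "\<And>i. i < r \<Longrightarrow> f i \<in> poly_ring {..<n}"
    and lin_pres: "linearly_presented n r f"
    and primary: "m_primary n (gen_ideal {..<n} (f ` {..<r}))"
    and L_gen: "gen_ideal {..<n+r} (L ` {..<N}) = sym_ideal n r f"
    and \<Theta>_in_B: "\<And>j l. j < N \<Longrightarrow> l < n \<Longrightarrow> \<Theta> j l \<in> poly_ring {n..<n+r}"
    and \<Theta>_jac: "\<And>j. j < N \<Longrightarrow> L j = (\<Sum>l<n. \<Theta> j l * Var l)"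
begin

section \<open>Syzygies as equations of the symmetric algebra\<close>

abbreviation J :: "'k mpoly set" where
  "J \<equiv> ideal_span (L ` {..<N})"

text \<open>Linear presentation enters here: an arbitrary syzygy is a combination of linear ones,
  and these give the generators of \<open>sym_ideal\<close>.\<close>

lemma syzygy_in_J:
  assumes "a \<in> syzygies n r f"
  shows "(\<Sum>i<r. a i * Var (n + i)) \<in> J"
proof -
  have linear: "(\<Sum>i<r. v i * Var (n + i)) \<in> J" if "v \<in> linear_syzygies n r f" for v
  proof -
    have "(\<Sum>i<r. v i * Var (n + i)) \<in> sym_ideal n r f"
      unfolding sym_ideal_def using that by (intro gen_ideal_base) blast
    then show ?thesis
      unfolding L_gen[symmetric] by (rule subsetD[OF gen_ideal_subset_ideal_span])
  qed
  have "a \<in> gen_submodule n (linear_syzygies n r f)"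
    using assms lin_pres by (simp add: linearly_presented_def)
  then obtain F c where F: "finite F" "F \<subseteq> linear_syzygies n r f" "a = (\<lambda>i. \<Sum>v\<in>F. c v * v i)"
    by (auto simp: gen_submodule_def)
  have "(\<Sum>i<r. a i * Var (n + i)) = (\<Sum>i<r. \<Sum>v\<in>F. c v * (v i * Var (n + i)))"
    by (simp add: F(3) sum_distrib_right mult.assoc)
  also have "\<dots> = (\<Sum>v\<in>F. c v * (\<Sum>i<r. v i * Var (n + i)))"
    by (subst sum.swap) (simp add: sum_distrib_left)
  also have "\<dots> \<in> J"
    using F(2) linear by - (rule ideal_sum[OF is_ideal_span], rule ideal_mult_left[OF is_ideal_span], blast)
  finally show ?thesis .
qed

text \<open>The Koszul syzygy of two generators need not be linear, which is why the equations of
  all syzygies are needed.\<close>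

lemma koszul_in_J:
  assumes "i < r" "j < r"
  shows "f j * Var (n + i) - f i * Var (n + j) \<in> J"
proof (cases "i = j")
  case True
  then show ?thesis
    by (simp add: ideal_0 is_ideal_span)
next
  case False
  let ?a = "\<lambda>t. if t = i then f j else if t = j then - f i else 0"
  have split: "(\<Sum>t<r. ?a t * g t) = f j * g i - f i * g j" for g :: "nat \<Rightarrow> 'k mpoly"
  proof -
    have "(\<Sum>t<r. ?a t * g t) = (\<Sum>t\<in>{i, j}. ?a t * g t)"
      using assms by (intro sum.mono_neutral_right) auto
    then show ?thesis
      using False by simp
  qed
  have "?a \<in> syzygies n r f"
    using assms f_in_S
    by (auto simp: syzygies_def split poly_ring_0 poly_ring_uminus)
  from syzygy_in_J[OF this] show ?thesis
    unfolding split .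
qed

text \<open>The difference is the combination of Koszul equations with coefficients
  \<open>c j\<close>. Thus, where \<open>x\<close> is invertible, the point \<open>T\<close> is
  proportional to \<open>f\<close> modulo \<open>J\<close>.\<close>

lemma power_congruence:
  assumes "x = (\<Sum>j<r. c j * f j)" "i < r"
  shows "x * Var (n + i) - f i * (\<Sum>j<r. c j * Var (n + j)) \<in> J"
proof -
  have "x * Var (n + i) - f i * (\<Sum>j<r. c j * Var (n + j))
      = (\<Sum>j<r. c j * (f j * Var (n + i) - f i * Var (n + j)))"
    by (simp add: assms(1) sum_distrib_left sum_distrib_right sum_subtractf algebra_simps)
  also have "\<dots> \<in> J"
    using assms(2) by (intro ideal_sum ideal_mult_left is_ideal_span koszul_in_J) auto
  finally show ?thesis .
qed

section \<open>Powers of the variables as combinations of the generators\<close>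

lemma Var_power_in_I:
  assumes "l < n"
  shows "\<exists>k. Var l ^ k \<in> ideal_span (f ` {..<r})"
proof -
  have "Var l \<in> radical {..<n} (gen_ideal {..<n} (f ` {..<r}))"
    using primary assms by (auto simp: m_primary_def intro!: gen_ideal_base)
  then show ?thesis
    using gen_ideal_subset_ideal_span unfolding radical_def by blast
qed

lemma Var_power_neq_0: "(Var l :: 'k mpoly) ^ k \<noteq> 0"
proof -
  have "(Var l :: 'k mpoly) \<noteq> 0"
    by (metis Var_def keys_single keys_zero insert_not_empty one_neq_zero)
  then show ?thesis
    by simp
qed

lemma ex_f_neq_0: "\<exists>i<r. f i \<noteq> 0"
proof (rule ccontr)
  assume "\<not> ?thesis"
  then have "f ` {..<r} \<subseteq> {0}"
    by auto
  then have "ideal_span (f ` {..<r}) \<subseteq> {0}"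
    by (intro ideal_span_minimal is_idealI) auto
  moreover obtain k where "Var 0 ^ k \<in> ideal_span (f ` {..<r})"
    using Var_power_in_I[of 0] n_pos by auto
  ultimately show False
    using Var_power_neq_0[of 0 k] by blast
qed

text \<open>Each \<open>f i\<close> lies in the maximal ideal and so vanishes at the origin, whereas
  a form of degree 0 equals its value there. A nonzero \<open>f i\<close> therefore has positive
  degree.\<close>

lemma degree_f: obtains d where "d > 0" "\<And>i. i < r \<Longrightarrow> homogeneous d (f i)"
proof -
  obtain d where d: "\<And>i. i < r \<Longrightarrow> homogeneous d (f i)"
    using lin_pres by (auto simp: linearly_presented_def)
  have "d > 0"
  proof (rule ccontr)
    assume "\<not> d > 0"
    obtain i where i: "i < r" "f i \<noteq> 0"
      using ex_f_neq_0 by blast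
    have "f i ^ 1 \<in> gen_ideal {..<n} (f ` {..<r})"
      using i by (auto intro!: gen_ideal_base)
    then have "f i \<in> radical {..<n} (gen_ideal {..<n} (f ` {..<r}))"
      unfolding radical_def using f_in_S i by blast
    then have "f i \<in> ideal_span (Var ` {..<n})"
      using primary gen_ideal_subset_ideal_span unfolding m_primary_def by blast
    then have "mp_eval Const (\<lambda>_. 0) (f i) \<in> {0 :: 'k mpoly}"
      by (rule ideal_span_hom_image[OF mp_eval_hom, rotated 2])
         (auto intro!: is_idealI simp: mp_eval_Var comm_ring_hom_Const)
    \<comment> \<open>Scaling by 0: under the assumption \<open>d = 0\<close> the factor
      \<open>0 ^ d\<close> is 1.\<close>
    moreover have "mp_eval Const (\<lambda>v. 0 * Var v) (f i) = 0 ^ d * mp_eval Const Var (f i)"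
      by (rule mp_eval_scale[OF d[OF i(1)]])
    ultimately show False
      using i(2) \<open>\<not> d > 0\<close> unfolding mp_eval_Const_Var mult_zero_left by simp
  qed
  then show ?thesis
    using that d by blast
qed

text \<open>Taking the parts of degree \<open>k\<close> makes the coefficients homogeneous. Their
  degree \<open>k - d\<close> will bound the degree of the complementary factor on a line.\<close>

lemma Var_power_combination:
  assumes "l < n" and d: "\<And>i. i < r \<Longrightarrow> homogeneous d (f i)"
  obtains k c where "Var l ^ k = (\<Sum>i<r. c i * f i)" "d \<le> k" "\<And>i. homogeneous (k - d) (c i)"
proof -
  interpret grade: comm_ring_hom grade by (rule comm_ring_hom_grade)
  obtain k where "Var l ^ k \<in> ideal_span (f ` {..<r})"
    using Var_power_in_I[OF assms(1)] by blast
  then obtain c where c: "Var l ^ k = (\<Sum>i<r. c i * f i)"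
    using ideal_span_image_finite[of "{..<r}" "Var l ^ k" f] by auto
  have "grade (Var l :: 'k mpoly) = monom (Var l) 1"
    by (intro grade_homogeneous) (auto simp: homogeneous_def Var_def mdeg_def)
  then have "monom (Var l ^ k) k = grade (Var l ^ k :: 'k mpoly)"
    by (simp only: grade.hom_power monom_power mult_1)
  also have "\<dots> = (\<Sum>i<r. grade (c i) * monom (f i) d)"
    unfolding c grade.hom_sum grade.hom_mult using d by (intro sum.cong) (simp_all add: grade_homogeneous)
  finally have "coeff (monom (Var l ^ k) k) k = coeff (\<Sum>i<r. grade (c i) * monom (f i) d) k"
    by simp
  then have eq: "Var l ^ k = (\<Sum>i<r. coeff (grade (c i) * monom (f i) d) k)"
    by (simp add: coeff_sum)
  have coeff: "coeff (grade (c i) * monom (f i) d) k = (if d \<le> k then coeff (grade (c i)) (k - d) * f i else 0)" for i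
    by (simp add: coeff_monom_mult mult.commute[of _ "monom _ _"] mult.commute[of "f i"])
  \<comment> \<open>Otherwise every summand would be zero, but the power of the variable is
    not.\<close>
  have "d \<le> k"
    using eq Var_power_neq_0[of l k] by (cases "d \<le> k") (simp_all add: coeff)
  then have "Var l ^ k = (\<Sum>i<r. coeff (grade (c i)) (k - d) * f i)"
    using eq by (simp add: coeff)
  then show ?thesis
    using \<open>d \<le> k\<close> homogeneous_coeff_grade by (rule that)
qed

section \<open>From elements of \<open>I(W)\<close> to \<open>J\<close> and to the maximal
  minors\<close>

lemma power_mult_image_ideal_in_J:
  assumes "p \<in> image_ideal n r f" "l < n"
  shows "\<exists>K. Var l ^ K * p \<in> J"
proof -
  let ?V = "{n..<n + r}" and ?E = "mp_eval Const (\<lambda>v. f (v - n))"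
  have p: "p \<in> poly_ring ?V" "?E p = 0"
    using assms(1) by (auto simp: image_ideal_def subst_eq_mp_eval)
  obtain d where d: "d > 0" "\<And>i. i < r \<Longrightarrow> homogeneous d (f i)"
    using degree_f by blast
  obtain k where "Var l ^ k \<in> ideal_span (f ` {..<r})"
    using Var_power_in_I[OF assms(2)] by blast
  then obtain c where c: "Var l ^ k = (\<Sum>i<r. c i * f i)"
    using ideal_span_image_finite[of "{..<r}" "Var l ^ k" f] by auto
  define u where "u = (\<Sum>j<r. c j * Var (n + j) :: 'k mpoly)"
  have component: "Var l ^ (k * s) * coeff (grade p) s \<in> J" for s
  proof -
    let ?q = "coeff (grade p) s"
    have "Var l ^ k * Var v - u * f (v - n) \<in> J" if "v \<in> ?V" for v
    proof -
      have "v - n < r" "n + (v - n) = v"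
        using that by auto
      then show ?thesis
        using power_congruence[OF c, of "v - n"] by (simp add: u_def mult.commute)
    qed
    \<comment> \<open>Both substitutions are scalings: on a form of degree \<open>s\<close> the
      first gives \<open>Var l ^ (k * s)\<close> times the form, the second \<open>u ^ s\<close>
      times its value at \<open>f\<close>.\<close>
    then have "mp_eval Const (\<lambda>v. Var l ^ k * Var v) ?q - mp_eval Const (\<lambda>v. u * f (v - n)) ?q \<in> J"
      by (intro mp_eval_congruence[OF is_ideal_span coeff_grade_in_poly_ring[OF p(1)]])
    moreover have "?E ?q = 0"
      using p d by (intro mp_eval_component_eq_0[of p ?V d]) auto
    ultimately show ?thesis
      unfolding mp_eval_scale[OF homogeneous_coeff_grade] mp_eval_Const_Var
      by (simp add: power_mult)
  qed
  let ?D = "degree (grade p)"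
  \<comment> \<open>All components have degree at most \<open>?D\<close>, so one exponent serves for
    all of them.\<close>
  have "Var l ^ (k * ?D) * coeff (grade p) s \<in> J" if "s \<le> ?D" for s
  proof -
    have "k * ?D = k * (?D - s) + k * s"
      using that by (simp add: distrib_left[symmetric])
    then have "Var l ^ (k * ?D) * coeff (grade p) s
        = Var l ^ (k * (?D - s)) * (Var l ^ (k * s) * coeff (grade p) s)"
      by (simp add: power_add mult.assoc)
    also have "\<dots> \<in> J"
      by (intro ideal_mult_left is_ideal_span component)
    finally show ?thesis .
  qed
  then have "(\<Sum>s\<le>?D. Var l ^ (k * ?D) * coeff (grade p) s) \<in> J"
    by (intro ideal_sum is_ideal_span) auto
  then show ?thesis
    unfolding sum_distrib_left[symmetric] sum_coeff_grade by blast
qed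

text \<open>Replacing \<open>x\<close> by a cofactor vector and fixing \<open>T\<close> maps
  \<open>J\<close> into the ideal of maximal minors and \<open>x_c\<close> to
  \<open>\<delta>\<close>. The conclusion is phrased with the radical of a colon ideal so that it
  passes to the ideal generated by the minors.\<close>

lemma minor_power_mult_in_maximal_minors:
  assumes p: "p \<in> image_ideal n r f" and "\<delta> \<in> minors N n \<Theta> (n - 1)"
  shows "\<delta> \<in> ideal_rad {a. a * p \<in> ideal_span (maximal_minors N n \<Theta>)}"
proof -
  let ?Q = "ideal_span (maximal_minors N n \<Theta>)"
  obtain \<rho> \<gamma> where \<delta>: "\<delta> = minor \<Theta> (n - 1) \<rho> \<gamma>"
    and \<rho>: "\<rho> ` {..<n - 1} \<subseteq> {..<N}" and \<gamma>: "\<gamma> ` {..<n - 1} \<subseteq> {..<n}"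
    using assms(2) by (auto simp: minors_def)
  have "card (\<gamma> ` {..<n - 1}) < card {..<n}"
    using card_image_le[of "{..<n - 1}" \<gamma>] n_pos by simp
  then have "\<not> {..<n} \<subseteq> \<gamma> ` {..<n - 1}"
    using card_mono[of "\<gamma> ` {..<n - 1}" "{..<n}"] by auto
  then obtain c where c: "c < n" "c \<notin> \<gamma> ` {..<n - 1}"
    by auto
  obtain w where w: "w c = \<delta>"
    "\<forall>j. (\<Sum>l<n. \<Theta> j l * w l) = minor \<Theta> (Suc (n - 1)) (\<rho>(n - 1 := j)) (\<gamma>(n - 1 := c))"
    unfolding \<delta> using minor_kernel_vector[OF \<gamma> c, of \<Theta> \<rho>] by blast
  define \<sigma> where "\<sigma> v = (if v < n then w v else Var v)" for v
  let ?h = "mp_eval Const \<sigma>"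
  interpret h: comm_ring_hom ?h by (rule mp_eval_hom)
  have h_B: "?h q = q" if "q \<in> poly_ring {n..<n + r}" for q
    using mp_eval_cong[OF that, of \<sigma> Var Const] by (simp add: \<sigma>_def mp_eval_Const_Var)
  have h_Var: "?h (Var l) = w l" if "l < n" for l
    using that by (simp add: mp_eval_Var comm_ring_hom_Const \<sigma>_def)
  have h_L: "?h (L j) \<in> ?Q" if "j < N" for j
  proof -
    have "?h (L j) = (\<Sum>l<n. \<Theta> j l * w l)"
      using that by (simp add: \<Theta>_jac hom_distribs h_B \<Theta>_in_B h_Var)
    also have "\<dots> \<in> minors N n \<Theta> (Suc (n - 1))"
      unfolding w(2)[rule_format] by (rule minor_in_minors_Suc[OF \<rho> that \<gamma> c(1)])
    finally show ?thesis
      using minors_subset_ideal_span_maximal_minors[of N n \<Theta>] n_pos by auto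
  qed
  have h_J: "?h q \<in> ?Q" if "q \<in> J" for q
    by (rule ideal_span_hom_image[OF mp_eval_hom is_ideal_span _ that]) (use h_L in auto)
  obtain K where "Var c ^ K * p \<in> J"
    using power_mult_image_ideal_in_J[OF p c(1)] by blast
  from h_J[OF this] have "\<delta> ^ K * p \<in> ?Q"
    using p c(1) by (simp add: hom_distribs h_B h_Var w(1) image_ideal_def)
  then show ?thesis
    by (auto simp: ideal_rad_def)
qed

section \<open>Radicals of the ideals of smaller minors\<close>

text \<open>If all minors of size \<open>e + 1\<close> vanish and \<open>\<delta>\<close> is invertible, then \<open>\<Theta>\<close> kills the points of a line, whose
  coordinates \<open>a\<close> and \<open>b\<close> are \<open>\<delta>\<close> and \<open>\<delta> * z\<close>. On that line the form \<open>f i\<close> divides a power of \<open>z\<close> while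
  being nonzero at \<open>z = 0\<close>, and the complementary factor has degree less than that power.\<close>

lemma minor_mult_T_in_rad_minors_Suc:
  assumes "i < r" "e + 2 \<le> n" "\<delta> \<in> minors N n \<Theta> e"
  shows "\<delta> * Var (n + i) \<in> ideal_rad (ideal_span (minors N n \<Theta> (Suc e)))"
proof -
  let ?Q = "ideal_span (minors N n \<Theta> (Suc e))" and ?T = "Var (n + i) :: 'k mpoly"
  have Q: "is_ideal ?Q"
    by (rule is_ideal_span)
  obtain d where d: "d > 0" "\<And>i. i < r \<Longrightarrow> homogeneous d (f i)"
    using degree_f by blast
  obtain \<rho> \<gamma> where \<delta>: "\<delta> = minor \<Theta> e \<rho> \<gamma>"
    and \<rho>: "\<rho> ` {..<e} \<subseteq> {..<N}" and \<gamma>: "\<gamma> ` {..<e} \<subseteq> {..<n}"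
    using assms(3) by (auto simp: minors_def)
  \<comment> \<open>At least two columns are left over by \<open>\<gamma>\<close>; each of them
    gives a kernel vector modulo \<open>?Q\<close>.\<close>
  have "\<not> card ({..<n} - \<gamma> ` {..<e}) \<le> Suc 0"
    using card_image_le[of "{..<e}" \<gamma>] assms(2) by (simp add: card_Diff_subset \<gamma>)
  then obtain a b where ab: "a < n" "a \<notin> \<gamma> ` {..<e}" "b < n" "b \<notin> \<gamma> ` {..<e}" "a \<noteq> b"
    unfolding card_le_Suc0_iff_eq[OF finite_Diff[OF finite_lessThan]] by blast
  obtain w where w: "w a = \<delta>" "\<forall>c. c \<noteq> a \<longrightarrow> c \<notin> \<gamma> ` {..<e} \<longrightarrow> w c = 0"
    "\<forall>j. (\<Sum>l<n. \<Theta> j l * w l) = minor \<Theta> (Suc e) (\<rho>(e := j)) (\<gamma>(e := a))"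
    unfolding \<delta> using minor_kernel_vector[OF \<gamma> ab(1,2), of \<Theta> \<rho>] by blast
  obtain w' where w': "w' b = \<delta>" "\<forall>c. c \<noteq> b \<longrightarrow> c \<notin> \<gamma> ` {..<e} \<longrightarrow> w' c = 0"
    "\<forall>j. (\<Sum>l<n. \<Theta> j l * w' l) = minor \<Theta> (Suc e) (\<rho>(e := j)) (\<gamma>(e := b))"
    unfolding \<delta> using minor_kernel_vector[OF \<gamma> ab(3,4), of \<Theta> \<rho>] by blast
  have w_b: "w b = 0" and w'_a: "w' a = 0"
    using ab w(2) w'(2) by auto
  \<comment> \<open>Restriction to the line \<open>w + z w'\<close>, where \<open>z\<close> is the
    new polynomial variable and the \<open>T\<close> variables stay constant.\<close>
  define \<sigma> where "\<sigma> v = (if v < n then [:w v, w' v:] else [:Var v:])" for v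
  let ?h = "mp_eval (\<lambda>c. [:Const c:]) \<sigma>"
  have hom: "comm_ring_hom ?h"
    by (rule comm_ring_hom_mp_eval[OF comm_ring_hom_pCons_Const])
  interpret h: comm_ring_hom ?h by (rule hom)
  have h_B: "?h q = [:q:]" if "q \<in> poly_ring {n..<n + r}" for q
    using mp_eval_cong[OF that, of \<sigma> "\<lambda>v. [:Var v:]"]
    by (simp add: \<sigma>_def mp_eval_pCons comm_ring_hom_Const mp_eval_Const_Var)
  have h_Var: "?h (Var l) = \<sigma> l" for l
    by (simp add: mp_eval_Var comm_ring_hom_pCons_Const)
  have h_T: "?h (Var (n + j)) = [:Var (n + j):]" for j
    by (simp add: h_Var \<sigma>_def)
  have h_L: "coeff (?h (L j)) t \<in> ?Q" if "j < N" for j t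
  proof -
    have "?h (L j) = (\<Sum>l<n. smult (\<Theta> j l) [:w l, w' l:])"
      using that by (simp add: \<Theta>_jac hom_distribs h_B \<Theta>_in_B h_Var \<sigma>_def mult.commute)
    then have "coeff (?h (L j)) t = (\<Sum>l<n. \<Theta> j l * coeff [:w l, w' l:] t)"
      by (simp only: coeff_sum coeff_smult)
    also have "\<dots> = (if t = 0 then \<Sum>l<n. \<Theta> j l * w l else if t = 1 then \<Sum>l<n. \<Theta> j l * w' l else 0)"
      by (cases t; cases "t - 1") auto
    also have "\<dots> \<in> ?Q"
      using ab by (simp add: w(3) w'(3) ideal_span_base ideal_0[OF Q] minor_in_minors_Suc[OF \<rho> that \<gamma>])
    finally show ?thesis .
  qed
  have h_J: "coeff (?h q) t \<in> ?Q" if "q \<in> J" for q t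
  proof -
    have "?h q \<in> {p. \<forall>i. coeff p i \<in> ?Q}"
      by (rule ideal_span_hom_image[OF hom is_ideal_coeffs[OF Q] _ that]) (use h_L in auto)
    then show ?thesis
      by blast
  qed
  obtain k c where c: "Var a ^ k = (\<Sum>i<r. c i * f i)" "d \<le> k" "\<And>i. homogeneous (k - d) (c i)"
    using Var_power_combination[OF ab(1) d(2)] by blast
  obtain k' c' where c': "Var b ^ k' = (\<Sum>i<r. c' i * f i)" "d \<le> k'" "\<And>i. homogeneous (k' - d) (c' i)"
    using Var_power_combination[OF ab(3) d(2)] by blast
  define g where "g = ?h (f i)"
  define u where "u = ?h (\<Sum>j<r. c j * Var (n + j))"
  define u' where "u' = ?h (\<Sum>j<r. c' j * Var (n + j))"
  have \<sigma>_a: "\<sigma> a = [:\<delta>:]"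
    using ab(1) by (simp add: \<sigma>_def w(1) w'_a)
  have "coeff (?h (Var a ^ k * ?T - f i * (\<Sum>j<r. c j * Var (n + j)))) 0 \<in> ?Q"
    by (rule h_J[OF power_congruence[OF c(1) assms(1)]])
  also have "?h (Var a ^ k * ?T - f i * (\<Sum>j<r. c j * Var (n + j))) = [:\<delta>:] ^ k * [:?T:] - g * u"
    unfolding g_def u_def h.hom_minus h.hom_mult h.hom_power h_T unfolding h_Var \<sigma>_a ..
  \<comment> \<open>The constant term in \<open>z\<close>: wherever \<open>\<delta>\<close> and
    \<open>?T\<close> are invertible modulo \<open>?Q\<close>, so is
    \<open>coeff g 0\<close>.\<close>
  finally have gu: "\<delta> ^ k * ?T - coeff g 0 * coeff u 0 \<in> ?Q"
    by (simp add: coeff_mult_0 coeff_0_power mult.commute)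
  have \<sigma>_b: "\<sigma> b = monom \<delta> 1"
    using ab(3) by (simp add: \<sigma>_def w'(1) w_b monom_Suc monom_0)
  have gu': "coeff (monom (\<delta> ^ k' * ?T) k') t - coeff (g * u') t \<in> ?Q" for t
  proof -
    have "coeff (?h (Var b ^ k' * ?T - f i * (\<Sum>j<r. c' j * Var (n + j)))) t \<in> ?Q"
      by (rule h_J[OF power_congruence[OF c'(1) assms(1)]])
    also have "?h (Var b ^ k' * ?T - f i * (\<Sum>j<r. c' j * Var (n + j))) = monom \<delta> 1 ^ k' * [:?T:] - g * u'"
      unfolding g_def u'_def h.hom_minus h.hom_mult h.hom_power h_T unfolding h_Var \<sigma>_b ..
    also have "monom \<delta> 1 ^ k' * [:?T:] = monom (\<delta> ^ k' * ?T) k'"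
      by (simp add: monom_power mult.commute[of _ "[:_:]"] smult_monom mult.commute)
    finally show ?thesis
      by simp
  qed
  have "degree u' \<le> k' - d"
    unfolding u'_def h.hom_sum
  proof (rule degree_sum_le)
    fix j
    have "degree (?h (c' j)) \<le> k' - d"
      by (rule degree_mp_eval_le[OF c'(3)]) (simp add: \<sigma>_def)
    then show "degree (?h (c' j * Var (n + j))) \<le> k' - d"
      using degree_mult_le[of "?h (c' j)" "[:Var (n + j):]"] by (simp add: h.hom_mult h_T)
  qed simp
  \<comment> \<open>Positivity of \<open>d\<close> makes the inequality strict, as the division
    argument for \<open>g * u'\<close> requires.\<close>
  then have deg: "degree u' < k'"
    using d(1) c'(2) by simp
  have "coeff (g * u') t \<in> ?Q" if "t < k'" for t
    using ideal_diff[OF Q ideal_0[OF Q] gu'[of t]] that by simp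
  then have "coeff g 0 ^ k' * coeff (g * u') k' \<in> ?Q"
    by (rule coeff_0_power_mult_in_ideal[OF Q deg])
  then have *: "coeff (g * u') k' * coeff g 0 ^ k' \<in> ?Q"
    by (simp only: mult.commute)
  have "\<delta> ^ k' * ?T - coeff (g * u') k' \<in> ?Q"
    using gu'[of k'] by (simp only: coeff_monom if_True refl)
  then have "\<delta> ^ k' * ?T * coeff g 0 ^ k' \<in> ?Q"
    using * by (rule ideal_mult_cong[OF Q])
  then have "coeff u 0 ^ k' * (\<delta> ^ k' * ?T * coeff g 0 ^ k') \<in> ?Q"
    by (rule ideal_mult_left[OF Q])
  \<comment> \<open>The extra factor \<open>coeff u 0 ^ k'\<close> completes the power of
    \<open>coeff g 0\<close>, so that \<open>gu\<close> can eliminate both.\<close>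
  then have "(coeff g 0 * coeff u 0) ^ k' * (\<delta> ^ k' * ?T) \<in> ?Q"
    by (simp only: power_mult_distrib mult_ac)
  with ideal_congruence_power[OF Q gu] have "(\<delta> ^ k * ?T) ^ k' * (\<delta> ^ k' * ?T) \<in> ?Q"
    by (rule ideal_mult_cong[OF Q])
  \<comment> \<open>The multiplier equalizes the exponents of \<open>\<delta>\<close> and
    \<open>?T\<close>.\<close>
  then have "(\<delta> * ?T ^ (k * k')) * ((\<delta> ^ k * ?T) ^ k' * (\<delta> ^ k' * ?T)) \<in> ?Q"
    by (rule ideal_mult_left[OF Q])
  also have "(\<delta> * ?T ^ (k * k')) * ((\<delta> ^ k * ?T) ^ k' * (\<delta> ^ k' * ?T)) = (\<delta> * ?T) ^ (k * k' + k' + 1)"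
    by (simp only: power_mult_distrib power_add power_mult[symmetric] power_one_right mult_ac)
  finally show ?thesis
    unfolding ideal_rad_def by blast
qed

text \<open>A power of \<open>T_i\<close> is a combination of minors of size \<open>e\<close>; one
  more factor \<open>T_i\<close> carries each of these into the radical for size
  \<open>e + 1\<close>. The induction starts from the empty minor 1.\<close>

lemma T_in_rad_minors:
  assumes "i < r" "e < n"
  shows "Var (n + i) \<in> ideal_rad (ideal_span (minors N n \<Theta> e))"
  using assms(2)
proof (induction e)
  case 0
  have "1 \<in> minors N n \<Theta> 0"
    by (auto simp: minors_def minor_def det_def')
  then have "Var (n + i) ^ 0 \<in> ideal_span (minors N n \<Theta> 0)"
    by (simp add: ideal_span_base)
  then show ?case
    unfolding ideal_rad_def by blast
next
  case (Suc e)
  let ?R = "ideal_rad (ideal_span (minors N n \<Theta> (Suc e)))" and ?T = "Var (n + i) :: 'k mpoly"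
  have "ideal_span (minors N n \<Theta> e) \<subseteq> {a. a * ?T \<in> ?R}"
    using Suc.prems assms(1) minor_mult_T_in_rad_minors_Suc
    by (intro ideal_span_minimal is_ideal_colon is_ideal_rad is_ideal_span) auto
  moreover obtain m where "?T ^ m \<in> ideal_span (minors N n \<Theta> e)"
    using Suc by (auto simp: ideal_rad_def)
  ultimately have "?T ^ Suc m \<in> ?R"
    by (auto simp: mult.commute)
  then show ?case
    by (rule ideal_rad_powerD)
qed

section \<open>The maximal minors in \<open>B\<close> and their vanishing on
  \<open>W\<close>\<close>

lemma maximal_minors_subset_poly_ring: "maximal_minors N n \<Theta> \<subseteq> poly_ring {n..<n + r}"
proof
  fix q assume "q \<in> maximal_minors N n \<Theta>"
  then obtain \<rho> where q: "q = minor \<Theta> n \<rho> (\<lambda>j. j)" and \<rho>: "\<rho> ` {..<n} \<subseteq> {..<N}"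
    by (auto simp: maximal_minors_def det_fun_eq_minor)
  interpret comm_ring_hom "retract {n..<n + r} :: 'k mpoly \<Rightarrow> _"
    by (rule comm_ring_hom_retract)
  have "map_mat (retract {n..<n + r}) (mat n n (\<lambda>(i, j). \<Theta> (\<rho> i) j)) = mat n n (\<lambda>(i, j). \<Theta> (\<rho> i) j)"
    using \<rho> \<Theta>_in_B by (intro eq_matI) (auto simp: poly_ring_iff_retract image_subset_iff)
  then show "q \<in> poly_ring {n..<n + r}"
    unfolding q minor_def poly_ring_iff_retract by (metis hom_det)
qed

lemma subst_maximal_minors_eq_0:
  assumes "q \<in> ideal_span (maximal_minors N n \<Theta>)"
  shows "mp_eval Const (\<lambda>v. if v < n then Var v else f (v - n)) q = 0"
proof -
  \<comment> \<open>The \<open>x\<close> variables are kept because they form the kernel vector; on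
    \<open>B\<close> this is the substitution that defines \<open>image_ideal\<close>.\<close>
  define \<sigma> where "\<sigma> v = (if v < n then Var v else f (v - n))" for v
  let ?h = "mp_eval Const \<sigma>"
  interpret h: comm_ring_hom ?h by (rule mp_eval_hom)
  have h_S: "?h q = q" if "q \<in> poly_ring {..<n}" for q
    using mp_eval_cong[OF that, of \<sigma> Var Const] by (simp add: \<sigma>_def mp_eval_Const_Var)
  have h_Var: "?h (Var v) = \<sigma> v" for v
    by (simp add: mp_eval_Var comm_ring_hom_Const)
  have ideal: "is_ideal {0 :: 'k mpoly}"
    by (intro is_idealI) auto
  \<comment> \<open>At \<open>T = f\<close> the equation of a syzygy becomes the syzygy relation
    itself.\<close>
  have gens: "?h (\<Sum>i<r. a i * Var (n + i)) = 0" if "a \<in> linear_syzygies n r f" for a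
    using that
    by (simp add: hom_distribs h_Var h_S linear_syzygies_def syzygies_def linear_form_def \<sigma>_def)
  have "?h (L j) = 0" if "j < N" for j
  proof -
    have "L j \<in> sym_ideal n r f"
      unfolding L_gen[symmetric] using that by (intro gen_ideal_base) auto
    then have "L j \<in> ideal_span {\<Sum>i<r. a i * Var (n + i) | a. a \<in> linear_syzygies n r f}"
      unfolding sym_ideal_def by (rule subsetD[OF gen_ideal_subset_ideal_span])
    then have "?h (L j) \<in> {0}"
      by (rule ideal_span_hom_image[OF mp_eval_hom ideal, rotated]) (auto simp: gens)
    then show ?thesis
      by simp
  qed
  then have kernel: "(\<Sum>l<n. ?h (\<Theta> j l) * Var l) = 0" if "j < N" for j
    using that by (simp add: \<Theta>_jac hom_distribs h_Var \<sigma>_def)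
  have "?h q \<in> {0}" if minor: "q \<in> maximal_minors N n \<Theta>" for q
  proof -
    obtain \<rho> where q: "q = minor \<Theta> n \<rho> (\<lambda>j. j)" and \<rho>: "\<rho> ` {..<n} \<subseteq> {..<N}"
      using minor by (auto simp: maximal_minors_def det_fun_eq_minor)
    have "map_mat ?h (mat n n (\<lambda>(i, j). \<Theta> (\<rho> i) j)) = mat n n (\<lambda>(i, j). ?h (\<Theta> (\<rho> i) j))"
      by (intro eq_matI) auto
    then have "?h q = minor (\<lambda>i l. ?h (\<Theta> (\<rho> i) l)) n (\<lambda>i. i) (\<lambda>j. j)"
      unfolding q minor_def by (metis h.hom_det)
    also have "\<dots> = det_fun n (\<lambda>i l. ?h (\<Theta> (\<rho> i) l))"
      by (rule det_fun_eq_minor[symmetric])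
    finally have hq: "?h q = det_fun n (\<lambda>i l. ?h (\<Theta> (\<rho> i) l))" .
    \<comment> \<open>One nonzero coordinate of the kernel vector suffices in a domain;
      \<open>n \<ge> 1\<close> provides it.\<close>
    have "?h q * Var 0 = 0"
      unfolding hq using n_pos \<rho> kernel by (intro det_fun_mult_kernel) auto
    then show ?thesis
      using Var_power_neq_0[of 0 1] by simp
  qed
  then have "?h q \<in> {0}"
    by (rule ideal_span_hom_image[OF mp_eval_hom ideal _ assms])
  then show ?thesis
    by (simp add: \<sigma>_def[abs_def])
qed

theorem saturation_eq_image_ideal:
  "saturation {n..<n + r} (gen_ideal {n..<n + r} (maximal_minors N n \<Theta>)) (Var ` {n..<n + r})
    = image_ideal n r f"
proof (intro equalityI subsetI)
  let ?V = "{n..<n + r}" and ?Q = "ideal_span (maximal_minors N n \<Theta>)"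
  have gen: "gen_ideal ?V (maximal_minors N n \<Theta>) = ?Q \<inter> poly_ring ?V"
    by (rule gen_ideal_eq_ideal_span[OF maximal_minors_subset_poly_ring])
  {
    fix p assume "p \<in> saturation ?V (gen_ideal ?V (maximal_minors N n \<Theta>)) (Var ` ?V)"
    then obtain k where p: "p \<in> poly_ring ?V"
      and k: "\<And>q. q \<in> ideal_pow ?V (Var ` ?V) k \<Longrightarrow> q * p \<in> ?Q"
      unfolding gen saturation_def by blast
    let ?h = "mp_eval Const (\<lambda>v. if v < n then Var v else f (v - n))"
    interpret h: comm_ring_hom ?h by (rule mp_eval_hom)
    \<comment> \<open>The power of \<open>T_i\<close> from the saturation becomes a power of this
      nonzero \<open>f i\<close>, which can be cancelled.\<close>
    obtain i where i: "i < r" "f i \<noteq> 0"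
      using ex_f_neq_0 by blast
    have "Var (n + i) ^ k * p \<in> ?Q"
      using i by (intro k power_in_ideal_pow) auto
    then have "?h (Var (n + i) ^ k * p) = 0"
      by (rule subst_maximal_minors_eq_0)
    then have "f i ^ k * ?h p = 0"
      by (simp add: hom_distribs mp_eval_Var comm_ring_hom_Const)
    then have "?h p = 0"
      using i by simp
    moreover have "?h p = subst (\<lambda>v. f (v - n)) p"
      unfolding subst_eq_mp_eval by (rule mp_eval_cong[OF p]) simp
    ultimately have "subst (\<lambda>v. f (v - n)) p = 0"
      by simp
    then show "p \<in> image_ideal n r f"
      using p by (simp add: image_ideal_def)
  next
    fix p assume p: "p \<in> image_ideal n r f"
    then have p_B: "p \<in> poly_ring ?V"
      by (simp add: image_ideal_def)
    let ?C = "{a. a * p \<in> ?Q}"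
    have C: "is_ideal ?C"
      by (intro is_ideal_colon is_ideal_span)
    \<comment> \<open>The radical of the colon ideal contains the minors of size
      \<open>n - 1\<close>, hence their ideal, hence a power of every \<open>T_i\<close>, and
      therefore \<open>T_i\<close> itself.\<close>
    have "ideal_span (minors N n \<Theta> (n - 1)) \<subseteq> ideal_rad ?C"
      using minor_power_mult_in_maximal_minors[OF p]
      by (intro ideal_span_minimal is_ideal_rad C) auto
    moreover have "\<exists>m. Var (n + i) ^ m \<in> ideal_span (minors N n \<Theta> (n - 1))" if "i < r" for i
      using T_in_rad_minors[OF that, of "n - 1"] n_pos by (auto simp: ideal_rad_def)
    ultimately have T: "Var (n + i) \<in> ideal_rad ?C" if "i < r" for i
      using that by (meson ideal_rad_powerD subsetD)
    have "Var v \<in> ideal_rad ?C" if "v \<in> ?V" for v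
    proof -
      have "v - n < r" "n + (v - n) = v"
        using that by auto
      then show ?thesis
        using T[of "v - n"] by simp
    qed
    then obtain k where k: "ideal_pow ?V (Var ` ?V) k \<subseteq> ?C"
      using ideal_pow_subset_ideal[OF _ C, of "Var ` ?V"] by blast
    have "q * p \<in> ?Q \<inter> poly_ring ?V" if "q \<in> ideal_pow ?V (Var ` ?V) k" for q
      using k that ideal_pow_subset_poly_ring[of "Var ` ?V" ?V k] p_B
      by (auto intro!: poly_ring_mult Var_in_poly_ring)
    then show "p \<in> saturation ?V (gen_ideal ?V (maximal_minors N n \<Theta>)) (Var ` ?V)"
      unfolding gen saturation_def using p_B by blast
  }
qed

end

theorem theorem2p11:
  fixes n r N :: nat
    and f :: "nat \<Rightarrow> 'k::field mpoly"
    and L :: "nat \<Rightarrow> 'k mpoly"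
    and \<Theta> :: "nat \<Rightarrow> nat \<Rightarrow> 'k mpoly"
  assumes "n \<ge> 1"
    and f_in_S: "\<forall>i<r. f i \<in> poly_ring {..<n}"
    and lin_pres: "linearly_presented n r f"
    and primary: "m_primary n (gen_ideal {..<n} (f ` {..<r}))"
    and L_bilinear: "\<forall>j<N. bilinear n r (L j)"
    and L_gen: "gen_ideal {..<n+r} (L ` {..<N}) = sym_ideal n r f"
    and L_minimal: "\<forall>j<N. L j \<notin> gen_ideal {..<n+r} (L ` ({..<N} - {j}))"
    and \<Theta>_linear: "\<forall>j<N. \<forall>l<n. linear_form {n..<n+r} (\<Theta> j l)"
    and \<Theta>_jac: "\<forall>j<N. L j = (\<Sum>l<n. \<Theta> j l * Var l)"
  shows "saturation {n..<n+r}
           (gen_ideal {n..<n+r} (maximal_minors N n \<Theta>))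
           (Var ` {n..<n+r})
         = image_ideal n r f"
proof -
  interpret jacobian_dual n r N f L \<Theta>
    by unfold_locales (use assms in \<open>auto simp: linear_form_def\<close>)
  show ?thesis
    by (rule saturation_eq_image_ideal)
qed

end
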